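(* Let $(M,d_M,f)$ be an augmented metric space and let $S$ be its density-Rips persistent set. Then the number of interval modules among the summands in the decomposition of $\mathcal{L}S$ into indecomposable summands is at least the number of $2$-cycles in the nearest neighbor graph of $M$.
   Context: Let $P$ be a finite poset, viewed as a category. A persistent set over $P$ is a functor $S\colon P\to\mathsf{Set}$ to finite sets; a persistence module over $P$ is a functor $P\to\mathsf{Vec}$ to finite-dimensional vector spaces over a fixed field $K$. Morphisms are natural transformations. The linearization functor $\mathcal{L}$ from persistent sets to persistence modules is postcomposition with the functor taking a finite set to the free $K$-vector space on it. Direct sums of persistence modules are taken pointwise; a persistence module $F$ is indecomposable if $F\cong F_1\oplus F_2$ implies $F_1=0$ or $F_2=0$. Decompositions into nonzero indecomposables are unique up to permutation and isomorphism of the summands (Krull-Schmidt). Let $I\subseteq P$ be a non-empty connected subposet such that $i\le l\le j$ with $i,j\in I$, $l\in P$ implies $l\in I$. The interval module supported on $I$ is the persistence module with value $K$ at $p\in I$ and $0$ at $p\notin I$, whose internal maps $p\to q$ are the identity if $p,q\in I$ and zero otherwise. Interval summands are counted with multiplicity, up to isomorphism. An augmented metric space is a triple $(M,d,f)$ with $(M,d)$ a finite metric space and $f\colon M\to\mathbb{R}$ a function. For $\sigma\in\mathbb{R}$ put $M_\sigma:=\{x\in M: f(x)\le\sigma\}$. For a finite metric space $N$ and $\varepsilon\ge 0$, $\mathcal{G}_\varepsilon(N)$ is the undirected graph with vertex set $N$ and an edge between $x,y$ whenever $d(x,y)\le\varepsilon$. Put $P:=D\times T\subset\mathbb{R}_{\ge0}\times\mathbb{R}$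 with $D:=\{d(x,y):x,y\in M\}$ and $T:=\{f(x):x\in M\}$, ordered by $(\varepsilon,\sigma)\le(\varepsilon',\sigma')$ iff $\varepsilon\le\varepsilon'$ and $\sigma\le\sigma'$. The density-Rips persistent set of $(M,d,f)$ is the functor $S\colon P\to\mathsf{Set}$ sending $(\varepsilon,\sigma)$ to the set of connected components of $\mathcal{G}_\varepsilon(M_\sigma)$, with maps induced by the inclusions of graphs. Fix a total order on $M$ compatible with the order induced by $f$ (if $f(x)<f(y)$ then $x$ precedes $y$). The nearest neighbor of $x\in M$ is the element $x'\ne x$ of $M$ at minimum distance from $x$, where ties are broken by the fixed total order (the first element in the order among those at minimum distance). The nearest neighbor graph of $M$ is the directed graph with vertex set $M$ and with edges $(x,x')$, where $x'$ is the nearest neighbor of $x$. A $2$-cycle is an unordered pair $\{x,y\}$ such that both $(x,y)$ and $(y,x)$ are edges, i.e. $x$ and $y$ are nearest neighbors of each other. *)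

theory Defs
  imports
    "HOL-Analysis.Abstract_Metric_Spaces"
    "HOL-Library.Function_Algebras"
    "HOL-Library.Product_Order"
begin

section \<open>Persistent sets and persistence modules over a poset\<close>

text \<open>
  The indexing poset is a (finite) set \<open>P\<close> of elements of an ordered type. Only the values at
  elements and comparable pairs of \<open>P\<close> are meaningful.
\<close>

record ('p, 's) pers_set =
  ps_obj :: "'p \<Rightarrow> 's set"
  ps_map :: "'p \<Rightarrow> 'p \<Rightarrow> 's \<Rightarrow> 's"

definition persistent_set :: "'p::order set \<Rightarrow> ('p, 's) pers_set \<Rightarrow> bool" where
  "persistent_set P S \<longleftrightarrow>
     (\<forall>p\<in>P. finite (ps_obj S p)) \<and>
     (\<forall>p\<in>P. \<forall>q\<in>P. p \<le> q \<longrightarrow> ps_map S p q \<in> ps_obj S p \<rightarrow> ps_obj S q) \<and>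
     (\<forall>p\<in>P. \<forall>x\<in>ps_obj S p. ps_map S p p x = x) \<and>
     (\<forall>p\<in>P. \<forall>q\<in>P. \<forall>r\<in>P. p \<le> q \<longrightarrow> q \<le> r \<longrightarrow>
        (\<forall>x\<in>ps_obj S p. ps_map S q r (ps_map S p q x) = ps_map S p r x))"

text \<open>
  A vector space is a finite-dimensional subspace of an ambient vector space, given by a type
  \<open>'v\<close> with a scalar multiplication \<open>s\<close>. Over a finite poset this loses nothing, since finitely many
  vector spaces embed into a common one.
\<close>

record ('p, 'v) pers_mod =
  pm_space :: "'p \<Rightarrow> 'v set"
  pm_map :: "'p \<Rightarrow> 'p \<Rightarrow> 'v \<Rightarrow> 'v"

definition linear_betw ::
  "('k::field \<Rightarrow> 'v::ab_group_add \<Rightarrow> 'v) \<Rightarrow> ('k \<Rightarrow> 'w::ab_group_add \<Rightarrow> 'w) \<Rightarrow>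
   'v set \<Rightarrow> 'w set \<Rightarrow> ('v \<Rightarrow> 'w) \<Rightarrow> bool" where
  "linear_betw s t V W \<phi> \<longleftrightarrow>
     \<phi> \<in> V \<rightarrow> W \<and>
     (\<forall>u\<in>V. \<forall>v\<in>V. \<phi> (u + v) = \<phi> u + \<phi> v) \<and>
     (\<forall>c. \<forall>v\<in>V. \<phi> (s c v) = t c (\<phi> v))"

definition persistence_module ::
  "('k::field \<Rightarrow> 'v::ab_group_add \<Rightarrow> 'v) \<Rightarrow> 'p::order set \<Rightarrow> ('p, 'v) pers_mod \<Rightarrow> bool" where
  "persistence_module s P F \<longleftrightarrow>
     vector_space s \<and>
     (\<forall>p\<in>P. \<exists>B. finite B \<and> pm_space F p = module.span s B) \<and>
     (\<forall>p\<in>P. \<forall>q\<in>P. p \<le> q \<longrightarrow> linear_betw s s (pm_space F p) (pm_space F q) (pm_map F p q)) \<and>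
     (\<forall>p\<in>P. \<forall>v\<in>pm_space F p. pm_map F p p v = v) \<and>
     (\<forall>p\<in>P. \<forall>q\<in>P. \<forall>r\<in>P. p \<le> q \<longrightarrow> q \<le> r \<longrightarrow>
        (\<forall>v\<in>pm_space F p. pm_map F q r (pm_map F p q v) = pm_map F p r v))"

definition pm_iso ::
  "('k::field \<Rightarrow> 'v::ab_group_add \<Rightarrow> 'v) \<Rightarrow> ('k \<Rightarrow> 'w::ab_group_add \<Rightarrow> 'w) \<Rightarrow> 'p::order set \<Rightarrow>
   ('p, 'v) pers_mod \<Rightarrow> ('p, 'w) pers_mod \<Rightarrow> bool" where
  "pm_iso s t P F G \<longleftrightarrow>
     (\<exists>\<phi>. (\<forall>p\<in>P. linear_betw s t (pm_space F p) (pm_space G p) (\<phi> p) \<and>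
                  bij_betw (\<phi> p) (pm_space F p) (pm_space G p)) \<and>
          (\<forall>p\<in>P. \<forall>q\<in>P. p \<le> q \<longrightarrow>
             (\<forall>v\<in>pm_space F p. \<phi> q (pm_map F p q v) = pm_map G p q (\<phi> p v))))"

definition pm_zero :: "'p set \<Rightarrow> ('p, 'v::zero) pers_mod \<Rightarrow> bool" where
  "pm_zero P F \<longleftrightarrow> (\<forall>p\<in>P. pm_space F p = {0})"

definition prod_scale ::
  "('k \<Rightarrow> 'v \<Rightarrow> 'v) \<Rightarrow> ('k \<Rightarrow> 'w \<Rightarrow> 'w) \<Rightarrow> 'k \<Rightarrow> 'v \<times> 'w \<Rightarrow> 'v \<times> 'w" where
  "prod_scale s t c = map_prod (s c) (t c)"

definition pm_sum2 :: "('p, 'v) pers_mod \<Rightarrow> ('p, 'w) pers_mod \<Rightarrow> ('p, 'v \<times> 'w) pers_mod" where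
  "pm_sum2 F G =
     \<lparr> pm_space = (\<lambda>p. pm_space F p \<times> pm_space G p),
       pm_map = (\<lambda>p q. map_prod (pm_map F p q) (pm_map G p q)) \<rparr>"

text \<open>
  Letting \<open>F\<^sub>1\<close> and \<open>F\<^sub>2\<close> range over modules in the same ambient space as \<open>F\<close> is no restriction:
  if \<open>F\<close> is isomorphic to any direct sum, then the summands are isomorphic to submodules of \<open>F\<close>.
\<close>

definition pm_indecomposable ::
  "('k::field \<Rightarrow> 'v::ab_group_add \<Rightarrow> 'v) \<Rightarrow> 'p::order set \<Rightarrow> ('p, 'v) pers_mod \<Rightarrow> bool" where
  "pm_indecomposable s P F \<longleftrightarrow>
     (\<forall>F\<^sub>1 F\<^sub>2. persistence_module s P F\<^sub>1 \<longrightarrow> persistence_module s P F\<^sub>2 \<longrightarrow>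
        pm_iso s (prod_scale s s) P F (pm_sum2 F\<^sub>1 F\<^sub>2) \<longrightarrow> pm_zero P F\<^sub>1 \<or> pm_zero P F\<^sub>2)"

text \<open>
  Direct sum of a list of modules: its elements are the sequences whose \<open>i\<close>-th entry lies in the
  \<open>i\<close>-th module, extended by \<open>0\<close> beyond the length of the list.
\<close>

definition fun_scale :: "('k \<Rightarrow> 'v \<Rightarrow> 'v) \<Rightarrow> 'k \<Rightarrow> ('i \<Rightarrow> 'v) \<Rightarrow> 'i \<Rightarrow> 'v" where
  "fun_scale s c v = (\<lambda>i. s c (v i))"

definition pm_sum :: "('p, 'v::zero) pers_mod list \<Rightarrow> ('p, nat \<Rightarrow> 'v) pers_mod" where
  "pm_sum Fs =
     \<lparr> pm_space = (\<lambda>p. {v. \<forall>i. if i < length Fs then v i \<in> pm_space (Fs ! i) p else v i = 0}),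
       pm_map = (\<lambda>p q v i. if i < length Fs then pm_map (Fs ! i) p q (v i) else 0) \<rparr>"

definition indecomposable_decomposition ::
  "('k::field \<Rightarrow> 'v::ab_group_add \<Rightarrow> 'v) \<Rightarrow> ('k \<Rightarrow> 'w::ab_group_add \<Rightarrow> 'w) \<Rightarrow> 'p::order set \<Rightarrow>
   ('p, 'v) pers_mod \<Rightarrow> ('p, 'w) pers_mod list \<Rightarrow> bool" where
  "indecomposable_decomposition s t P F Fs \<longleftrightarrow>
     (\<forall>G\<in>set Fs. persistence_module t P G \<and> \<not> pm_zero P G \<and> pm_indecomposable t P G) \<and>
     pm_iso s (fun_scale t) P F (pm_sum Fs)"

definition poset_interval :: "'p::order set \<Rightarrow> 'p set \<Rightarrow> bool" where
  "poset_interval P I \<longleftrightarrow>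
     I \<subseteq> P \<and> I \<noteq> {} \<and>
     (\<forall>i\<in>I. \<forall>j\<in>I. (i, j) \<in> {(a, b). a \<in> I \<and> b \<in> I \<and> (a \<le> b \<or> b \<le> a)}\<^sup>*) \<and>
     (\<forall>i\<in>I. \<forall>j\<in>I. \<forall>l\<in>P. i \<le> l \<longrightarrow> l \<le> j \<longrightarrow> l \<in> I)"

text \<open>The ambient vector space is the field itself, with scalar multiplication \<open>(*)\<close>.\<close>

definition interval_module :: "'p set \<Rightarrow> ('p, 'k::field) pers_mod" where
  "interval_module I =
     \<lparr> pm_space = (\<lambda>p. if p \<in> I then UNIV else {0}),
       pm_map = (\<lambda>p q v. if p \<in> I \<and> q \<in> I then v else 0) \<rparr>"

definition is_interval_module ::
  "('k::field \<Rightarrow> 'v::ab_group_add \<Rightarrow> 'v) \<Rightarrow> 'p::order set \<Rightarrow> ('p, 'v) pers_mod \<Rightarrow> bool" where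
  "is_interval_module s P F \<longleftrightarrow>
     (\<exists>I. poset_interval P I \<and> pm_iso s (*) P F (interval_module I))"

text \<open>
  The free vector space on a finite set \<open>A\<close> consists of the functions vanishing outside \<open>A\<close>, with
  scalar multiplication \<open>fun_scale (*)\<close>; a map of sets pushes coefficients forward, adding them up
  along fibres.
\<close>

definition linearization :: "('p, 's) pers_set \<Rightarrow> ('p, 's \<Rightarrow> 'k::field) pers_mod" where
  "linearization S =
     \<lparr> pm_space = (\<lambda>p. {v. \<forall>x. x \<notin> ps_obj S p \<longrightarrow> v x = 0}),
       pm_map = (\<lambda>p q v y. \<Sum>x | x \<in> ps_obj S p \<and> ps_map S p q x = y. v x) \<rparr>"


section \<open>The density-Rips persistent set\<close>

definition sublevel :: "'m set \<Rightarrow> ('m \<Rightarrow> real) \<Rightarrow> real \<Rightarrow> 'm set" where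
  "sublevel M f \<sigma> = {x \<in> M. f x \<le> \<sigma>}"

definition rips_edges :: "('m \<Rightarrow> 'm \<Rightarrow> real) \<Rightarrow> 'm set \<Rightarrow> real \<Rightarrow> ('m \<times> 'm) set" where
  "rips_edges d N \<epsilon> = {(x, y). x \<in> N \<and> y \<in> N \<and> d x y \<le> \<epsilon>}"

definition density_rips_poset ::
  "'m set \<Rightarrow> ('m \<Rightarrow> 'm \<Rightarrow> real) \<Rightarrow> ('m \<Rightarrow> real) \<Rightarrow> (real \<times> real) set" where
  "density_rips_poset M d f = {d x y | x y. x \<in> M \<and> y \<in> M} \<times> f ` M"

text \<open>
  A connected component is represented by its vertex set, that is, by a class of the reachability
  relation. The map induced by an inclusion of graphs sends a component to the set of vertices
  reachable from it in the larger graph.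
\<close>

definition density_rips ::
  "'m set \<Rightarrow> ('m \<Rightarrow> 'm \<Rightarrow> real) \<Rightarrow> ('m \<Rightarrow> real) \<Rightarrow> (real \<times> real, 'm set) pers_set" where
  "density_rips M d f =
     \<lparr> ps_obj = (\<lambda>(\<epsilon>, \<sigma>). sublevel M f \<sigma> // (rips_edges d (sublevel M f \<sigma>) \<epsilon>)\<^sup>*),
       ps_map = (\<lambda>p (\<epsilon>, \<sigma>) C. (rips_edges d (sublevel M f \<sigma>) \<epsilon>)\<^sup>* `` C) \<rparr>"


section \<open>The nearest neighbor graph\<close>

text \<open>Here \<open>(x, y) \<in> r\<close> means that \<open>x\<close> precedes or equals \<open>y\<close>.\<close>

definition compatible_order :: "'m set \<Rightarrow> ('m \<Rightarrow> real) \<Rightarrow> 'm rel \<Rightarrow> bool" where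
  "compatible_order M f r \<longleftrightarrow>
     linear_order_on M r \<and> (\<forall>x\<in>M. \<forall>y\<in>M. f x < f y \<longrightarrow> (x, y) \<in> r)"

definition nearest_neighbor ::
  "'m set \<Rightarrow> ('m \<Rightarrow> 'm \<Rightarrow> real) \<Rightarrow> 'm rel \<Rightarrow> 'm \<Rightarrow> 'm \<Rightarrow> bool" where
  "nearest_neighbor M d r x y \<longleftrightarrow>
     y \<in> M - {x} \<and> (\<forall>z\<in>M - {x}. d x y \<le> d x z) \<and>
     (\<forall>z\<in>M - {x}. d x z = d x y \<longrightarrow> (y, z) \<in> r)"

definition nn_edges :: "'m set \<Rightarrow> ('m \<Rightarrow> 'm \<Rightarrow> real) \<Rightarrow> 'm rel \<Rightarrow> ('m \<times> 'm) set" where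
  "nn_edges M d r = {(x, y). x \<in> M \<and> nearest_neighbor M d r x y}"

definition two_cycles :: "('m \<times> 'm) set \<Rightarrow> 'm set set" where
  "two_cycles E = {{x, y} | x y. (x, y) \<in> E \<and> (y, x) \<in> E}"


section \<open>Well-definedness\<close>

lemma persistent_set_density_rips:
  assumes "finite M"
  shows "persistent_set (density_rips_poset M d f) (density_rips M d f)"
proof -
  let ?E = "\<lambda>p. rips_edges d (sublevel M f (snd p)) (fst p)"
  have obj: "ps_obj (density_rips M d f) p = sublevel M f (snd p) // (?E p)\<^sup>*" for p
    by (simp add: density_rips_def split_beta)
  have map: "ps_map (density_rips M d f) p q C = (?E q)\<^sup>* `` C" for p q C
    by (simp add: density_rips_def split_beta)
  have mono: "(?E p)\<^sup>* \<subseteq> (?E q)\<^sup>*" and vsub: "sublevel M f (snd p) \<subseteq> sublevel M f (snd q)"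
    if "p \<le> q" for p q
    proof -
    have le: "fst p \<le> fst q" "snd p \<le> snd q"
      using that by (simp_all add: less_eq_prod_def)
    show "(?E p)\<^sup>* \<subseteq> (?E q)\<^sup>*"
      using le by (intro rtrancl_mono) (auto simp: rips_edges_def sublevel_def)
    show "sublevel M f (snd p) \<subseteq> sublevel M f (snd q)"
      using le by (auto simp: sublevel_def)
  qed
  have absorb: "R\<^sup>* `` (Q\<^sup>* `` A) = R\<^sup>* `` A" if "Q\<^sup>* \<subseteq> R\<^sup>*" for Q R :: "('a \<times> 'a) set" and A
    using that by (auto intro: rtrancl_trans)
  have fin: "finite (sublevel M f \<sigma>)" for \<sigma>
    using assms by (simp add: sublevel_def)
  show ?thesis
    unfolding persistent_set_def Pi_iff obj map
  proof (intro conjI ballI impI)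
    fix p show "finite (sublevel M f (snd p) // (?E p)\<^sup>*)"
      using fin by (simp add: quotient_def)
  next
    fix p q :: "real \<times> real" and C
    assume le: "p \<le> q" and "C \<in> sublevel M f (snd p) // (?E p)\<^sup>*"
    then obtain x where x: "x \<in> sublevel M f (snd p)" "C = (?E p)\<^sup>* `` {x}"
      by (auto elim: quotientE)
    then have "(?E q)\<^sup>* `` C = (?E q)\<^sup>* `` {x}"
      using absorb[OF mono[OF le]] by simp
    then show "(?E q)\<^sup>* `` C \<in> sublevel M f (snd q) // (?E q)\<^sup>*"
      using vsub[OF le] x(1) quotientI by (metis subsetD)
  next
    fix p C assume "C \<in> sublevel M f (snd p) // (?E p)\<^sup>*"
    then show "(?E p)\<^sup>* `` C = C"
      using absorb by (auto elim!: quotientE)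
  next
    fix p q r :: "real \<times> real" and C assume "q \<le> r"
    then show "(?E r)\<^sup>* `` ((?E q)\<^sup>* `` C) = (?E r)\<^sup>* `` C"
      using absorb mono by blast
  qed
qed

lemma vector_space_fun_scale:
  "vector_space s \<Longrightarrow> vector_space (fun_scale s)"
  by (simp add: vector_space_def fun_scale_def fun_eq_iff)

lemma vector_space_times: "vector_space ((*) :: 'k::field \<Rightarrow> 'k \<Rightarrow> 'k)"
  by (simp add: vector_space_def algebra_simps)

lemma persistence_module_linearization:
  assumes "persistent_set P S"
  shows "persistence_module (fun_scale (*)) P (linearization S :: ('p::order, 's \<Rightarrow> 'k::field) pers_mod)"
proof -
  let ?F = "linearization S :: ('p, 's \<Rightarrow> 'k) pers_mod"
  interpret vector_space "fun_scale (*) :: 'k \<Rightarrow> ('s \<Rightarrow> 'k) \<Rightarrow> 's \<Rightarrow> 'k"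
    by (intro vector_space_fun_scale vector_space_times)
  have fin: "finite (ps_obj S p)" if "p \<in> P" for p
    using assms that by (simp add: persistent_set_def)
  have into: "ps_map S p q x \<in> ps_obj S q" if "p \<in> P" "q \<in> P" "p \<le> q" "x \<in> ps_obj S p" for p q x
    using assms that by (auto simp: persistent_set_def Pi_iff)
  have ide: "ps_map S p p x = x" if "p \<in> P" "x \<in> ps_obj S p" for p x
    using assms that by (auto simp: persistent_set_def)
  have comp: "ps_map S q r (ps_map S p q x) = ps_map S p r x"
    if "p \<in> P" "q \<in> P" "r \<in> P" "p \<le> q" "q \<le> r" "x \<in> ps_obj S p" for p q r x
    using assms that unfolding persistent_set_def by blast
  show ?thesis
    unfolding persistence_module_def
  proof (intro conjI ballI impI)
    show "vector_space (fun_scale (*) :: 'k \<Rightarrow> ('s \<Rightarrow> 'k) \<Rightarrow> 's \<Rightarrow> 'k)"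
      by (rule vector_space_axioms)
  next
    fix p assume p: "p \<in> P"
    let ?e = "\<lambda>x y. if y = x then 1 else 0 :: 'k"
    let ?B = "?e ` ps_obj S p"
    have sub: "subspace (pm_space ?F p)"
      by (auto simp: subspace_def linearization_def fun_scale_def)
    have "pm_space ?F p = span ?B"
    proof
      show "span ?B \<subseteq> pm_space ?F p"
        by (intro span_minimal sub) (auto simp: linearization_def)
      show "pm_space ?F p \<subseteq> span ?B"
      proof
        fix v assume v: "v \<in> pm_space ?F p"
        have sum_app: "(\<Sum>x\<in>A. g x) y = (\<Sum>x\<in>A. g x y)" for A :: "'s set" and g :: "'s \<Rightarrow> 's \<Rightarrow> 'k" and y
          by (induction A rule: infinite_finite_induct) auto
        have "v = (\<Sum>x\<in>ps_obj S p. fun_scale (*) (v x) (?e x))"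
          using v fin[OF p]
          by (auto simp: fun_eq_iff sum_app fun_scale_def linearization_def if_distrib cong: if_cong)
        also have "\<dots> \<in> span ?B"
          by (intro span_sum span_scale span_base) auto
        finally show "v \<in> span ?B" .
      qed
    qed
    then show "\<exists>B. finite B \<and> pm_space ?F p = span B"
      using fin[OF p] by blast
  next
    fix p q assume pq: "p \<in> P" "q \<in> P" "p \<le> q"
    have "{x. x \<in> ps_obj S p \<and> ps_map S p q x = y} = {}" if "y \<notin> ps_obj S q" for y
      using into[OF pq] that by auto
    then show "linear_betw (fun_scale (*)) (fun_scale (*)) (pm_space ?F p) (pm_space ?F q) (pm_map ?F p q)"
      by (auto simp: linear_betw_def linearization_def fun_scale_def fun_eq_iff sum.distrib sum_distrib_left
          intro!: sum.neutral)
  next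
    fix p v assume p: "p \<in> P" and v: "v \<in> pm_space ?F p"
    have "{x. x \<in> ps_obj S p \<and> ps_map S p p x = y} = (if y \<in> ps_obj S p then {y} else {})" for y
      using ide[OF p] by auto
    then show "pm_map ?F p p v = v"
      using v by (auto simp: linearization_def fun_eq_iff)
  next
    fix p q r v assume pqr: "p \<in> P" "q \<in> P" "r \<in> P" "p \<le> q" "q \<le> r"
    have "(\<Sum>y | y \<in> ps_obj S q \<and> ps_map S q r y = z. \<Sum>x | x \<in> ps_obj S p \<and> ps_map S p q x = y. v x)
        = (\<Sum>x | x \<in> ps_obj S p \<and> ps_map S p r x = z. v x)" for z and v :: "'s \<Rightarrow> 'k"
    proof -
      have "(\<Sum>y\<in>{y \<in> ps_obj S q. ps_map S q r y = z}.
               \<Sum>x\<in>{x \<in> {x \<in> ps_obj S p. ps_map S p r x = z}. ps_map S p q x = y}. v x)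
          = (\<Sum>x | x \<in> ps_obj S p \<and> ps_map S p r x = z. v x)"
        using pqr fin into comp[OF pqr] by (intro sum.group) auto
      moreover have "(\<Sum>x\<in>{x \<in> {x \<in> ps_obj S p. ps_map S p r x = z}. ps_map S p q x = y}. v x)
          = (\<Sum>x | x \<in> ps_obj S p \<and> ps_map S p q x = y. v x)"
        if "y \<in> {y \<in> ps_obj S q. ps_map S q r y = z}" for y
        using comp[OF pqr] that by (intro sum.cong) auto
      ultimately show ?thesis by (metis (no_types, lifting) sum.cong)
    qed
    then show "pm_map ?F q r (pm_map ?F p q v) = pm_map ?F p r v"
      by (simp add: linearization_def)
  qed
qed

lemma persistence_module_interval:
  assumes "poset_interval P I"
  shows "persistence_module (*) P (interval_module I :: ('p::order, 'k::field) pers_mod)"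
proof -
  have "pm_space (interval_module I :: ('p, 'k) pers_mod) p = module.span (*) (if p \<in> I then {1} else {})" for p
    by (auto simp: interval_module_def vector_space_over_itself.span_singleton
        vector_space_over_itself.span_empty)
  then have fin: "\<exists>B. finite B \<and> pm_space (interval_module I :: ('p, 'k) pers_mod) p = module.span (*) B" for p
    by (metis finite.emptyI finite.insertI)
  have conv: "q \<in> I" if "p \<in> I" "r \<in> I" "q \<in> P" "p \<le> q" "q \<le> r" for p q r
    using assms that unfolding poset_interval_def by blast
  show ?thesis
    unfolding persistence_module_def
  proof (intro conjI ballI impI)
    fix p q r and v :: 'k
    assume "q \<in> P" "p \<le> q" "q \<le> r" "v \<in> pm_space (interval_module I) p"
    then show "pm_map (interval_module I) q r (pm_map (interval_module I) p q v)
        = pm_map (interval_module I) p r v"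
      using conv[of p r q] by (simp add: interval_module_def)
  qed (use vector_space_times fin in \<open>simp_all add: linear_betw_def interval_module_def split: if_splits\<close>)
qed

end

theory Submission
  imports Defs
begin

text \<open>
  A pair of mutual nearest neighbors \<open>x\<close>, \<open>y\<close> with \<open>f x \<le> f y\<close> contributes an interval summand for
  an elementary reason. At scales below \<open>d x y\<close> both points are isolated vertices of the graph, and at
  scale \<open>d x y\<close> they are joined. Hence the difference of their components, which exists once
  \<open>y\<close> has entered, is an element of the linearization that survives exactly on the region
  \<open>f y \<le> \<sigma>\<close>, \<open>\<epsilon> < d x y\<close>; it defines a morphism \<open>a\<close> from the interval module on this region. Reading
  off the coefficient of the component \<open>{y}\<close> is a morphism \<open>b\<close> back
  (\<open>pm_hom_difference_class\<close>, \<open>pm_hom_coefficient\<close>), and \<open>b \<circ> a\<close> is the identity. Distinct two-cycles are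
  disjoint (\<open>two_cycles_disjoint\<close>), so for two cycles with the same region the morphism \<open>b\<close> of one
  annihilates the morphism \<open>a\<close> of the other.

  It remains to see that such a dual family forces as many interval summands in \<^emph>\<open>every\<close> decomposition
  into indecomposables. This is \<open>card_le_interval_summands\<close>. Inserting the decomposition between \<open>a\<close>
  and \<open>b\<close> writes the identity matrix, indexed by the two-cycles, as a sum of one matrix for each summand. An indecomposable summand
  through which a nonzero endomorphism of an interval module factors is isomorphic to that module
  (\<open>indecomposable_factor_interval\<close>), because it carries a nonzero idempotent; so only interval summands
  contribute, and since endomorphisms of interval modules are scalars, each contributes a matrix of rank
  at most one. Comparing ranks gives the inequality.

  That decompositions exist at all (\<open>exists_indecomposable_decomposition\<close>) follows by splitting
  along idempotents, with induction on the total dimension.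
\<close>

section \<open>Finite-dimensional subspaces\<close>

context vector_space
begin

lemma subspace_of_span_finite:
  assumes "finite B" and "subspace W" and "W \<subseteq> span B"
  shows "\<exists>C. finite C \<and> W = span C"
proof -
  obtain C where C: "C \<subseteq> W" "independent C" "W \<subseteq> span C"
    using maximal_independent_subset by blast
  then have "finite C"
    using independent_span_bound[of B C] assms by auto
  moreover have "span C \<subseteq> W"
    using C(1) assms(2) by (rule span_minimal)
  ultimately show ?thesis using C(3) by blast
qed

text \<open>
  The ambient space may have infinite dimension, so the exchange lemma is applied by hand: a basis of
  \<open>W\<close> together with one vector of \<open>V\<close> outside \<open>W\<close> is independent inside \<open>V\<close> and cannot outnumber
  a basis of \<open>V\<close>.
\<close>

lemma dim_strict_mono_of_finite_span:
  assumes B: "finite B" "V = span B" and W: "subspace W" "W \<subset> V"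
  shows "dim W < dim V"
proof -
  obtain C where C: "C \<subseteq> W" "independent C" "W \<subseteq> span C" "card C = dim W"
    using basis_exists by blast
  obtain x where x: "x \<in> V" "x \<notin> W" using W by blast
  have "span C \<subseteq> W" using C(1) W(1) by (rule span_minimal)
  then have ind: "independent (insert x C)"
    using x C(2) by (auto simp: independent_insert)
  obtain D where D: "D \<subseteq> V" "independent D" "V \<subseteq> span D" "card D = dim V"
    using basis_exists by blast
  have "finite D" using independent_span_bound[OF B(1) D(2)] D(1) B(2) by simp
  then have "finite (insert x C) \<and> card (insert x C) \<le> card D"
    using ind C(1) W(2) x D(3) by (intro independent_span_bound) auto
  moreover have "x \<notin> C" using x C(1) by blast
  ultimately show ?thesis using C(4) D(4) by auto
qed

end

lemma independent_standard_functions: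
  "\<not> module.dependent (fun_scale ((*) :: 'k::field \<Rightarrow> 'k \<Rightarrow> 'k)) ((\<lambda>c c'. if c' = c then 1 else 0) ` C)"
proof -
  interpret vector_space "fun_scale (*) :: 'k \<Rightarrow> ('a \<Rightarrow> 'k) \<Rightarrow> 'a \<Rightarrow> 'k"
    by (intro vector_space_fun_scale vector_space_times)
  let ?e = "\<lambda>c c'. if c' = c then 1 else 0 :: 'k"
  have sub: "subspace {v :: 'a \<Rightarrow> 'k. v c = 0}" for c
    by (auto simp: subspace_def fun_scale_def)
  show ?thesis
    unfolding dependent_def
  proof clarify
    fix c assume "?e c \<in> span (?e ` C - {?e c})"
    also have "span (?e ` C - {?e c}) \<subseteq> {v. v c = 0}"
      by (intro span_minimal sub) auto
    finally show False by simp
  qed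
qed

text \<open>
  The hypothesis writes the identity matrix of size \<open>card C\<close> as a sum of \<open>card J\<close> matrices of rank
  at most one, and rank is subadditive. In terms of vectors: the standard basis vectors lie in the span
  of the \<open>card J\<close> vectors \<open>\<beta> i\<close>.
\<close>

lemma card_le_of_rank_one_sum:
  fixes \<alpha> \<beta> :: "'i \<Rightarrow> 'c \<Rightarrow> 'k::field"
  assumes "finite C" and "finite J"
    and delta: "\<And>c c'. c \<in> C \<Longrightarrow> c' \<in> C \<Longrightarrow> (\<Sum>i\<in>J. \<beta> i c' * \<alpha> i c) = (if c' = c then 1 else 0)"
  shows "card C \<le> card J"
proof -
  interpret vector_space "fun_scale (*) :: 'k \<Rightarrow> ('c \<Rightarrow> 'k) \<Rightarrow> 'c \<Rightarrow> 'k"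
    by (intro vector_space_fun_scale vector_space_times)
  let ?e = "\<lambda>c c'. if c' = c then 1 else 0 :: 'k"
  \<comment> \<open>Nothing is assumed about \<open>\<beta>\<close> outside \<open>C\<close>, where the functions \<open>?e c\<close> vanish.\<close>
  define b where "b = (\<lambda>i c'. of_bool (c' \<in> C) * \<beta> i c')"
  have sum_app: "(\<Sum>i\<in>A. g i) y = (\<Sum>i\<in>A. g i y)" for A :: "'i set" and g :: "'i \<Rightarrow> 'c \<Rightarrow> 'k" and y
    by (induction A rule: infinite_finite_induct) auto
  have "?e c \<in> span (b ` J)" if "c \<in> C" for c
  proof -
    have "?e c = (\<Sum>i\<in>J. fun_scale (*) (\<alpha> i c) (b i))"
    proof
      fix c'
      have "(\<Sum>i\<in>J. \<alpha> i c * b i c') = of_bool (c' \<in> C) * (\<Sum>i\<in>J. \<beta> i c' * \<alpha> i c)"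
        by (simp add: b_def sum_distrib_left mult_ac)
      also have "\<dots> = ?e c c'"
        using delta[OF that, of c'] that by (cases "c' \<in> C") auto
      finally have "(\<Sum>i\<in>J. \<alpha> i c * b i c') = ?e c c'" .
      then show "?e c c' = (\<Sum>i\<in>J. fun_scale (*) (\<alpha> i c) (b i)) c'"
        by (simp add: sum_app fun_scale_def)
    qed
    also have "\<dots> \<in> span (b ` J)"
      by (intro span_sum span_scale span_base) auto
    finally show ?thesis .
  qed
  then have "?e ` C \<subseteq> span (b ` J)"
    by blast
  then have "card (?e ` C) \<le> card (b ` J)"
    using independent_span_bound[OF finite_imageI[OF assms(2)] independent_standard_functions] by blast
  also have "\<dots> \<le> card J"
    by (rule card_image_le) (rule assms(2))
  also have "card (?e ` C) = card C"
  proof (intro card_image inj_onI)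
    fix c1 c2 assume "?e c1 = ?e c2"
    then have "?e c1 c1 = ?e c2 c1" by (rule fun_cong)
    then show "c1 = c2" by (simp split: if_splits)
  qed
  finally show ?thesis .
qed

section \<open>Morphisms of persistence modules\<close>

definition pm_hom ::
  "('k::field \<Rightarrow> 'v::ab_group_add \<Rightarrow> 'v) \<Rightarrow> ('k \<Rightarrow> 'w::ab_group_add \<Rightarrow> 'w) \<Rightarrow> 'p::order set \<Rightarrow>
   ('p, 'v) pers_mod \<Rightarrow> ('p, 'w) pers_mod \<Rightarrow> ('p \<Rightarrow> 'v \<Rightarrow> 'w) \<Rightarrow> bool" where
  "pm_hom s t P F G \<phi> \<longleftrightarrow>
     (\<forall>p\<in>P. linear_betw s t (pm_space F p) (pm_space G p) (\<phi> p)) \<and>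
     (\<forall>p\<in>P. \<forall>q\<in>P. p \<le> q \<longrightarrow>
        (\<forall>v\<in>pm_space F p. \<phi> q (pm_map F p q v) = pm_map G p q (\<phi> p v)))"

lemma pm_iso_iff_bij_hom:
  "pm_iso s t P F G \<longleftrightarrow>
     (\<exists>\<phi>. pm_hom s t P F G \<phi> \<and> (\<forall>p\<in>P. bij_betw (\<phi> p) (pm_space F p) (pm_space G p)))"
  unfolding pm_iso_def pm_hom_def by (rule iff_exI) (simp only: ball_conj_distrib conj_ac)

lemma pm_homD:
  assumes "pm_hom s t P F G \<phi>" and "p \<in> P"
  shows "v \<in> pm_space F p \<Longrightarrow> \<phi> p v \<in> pm_space G p"
    and "u \<in> pm_space F p \<Longrightarrow> v \<in> pm_space F p \<Longrightarrow> \<phi> p (u + v) = \<phi> p u + \<phi> p v"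
    and "v \<in> pm_space F p \<Longrightarrow> \<phi> p (s c v) = t c (\<phi> p v)"
    and "q \<in> P \<Longrightarrow> p \<le> q \<Longrightarrow> v \<in> pm_space F p \<Longrightarrow> \<phi> q (pm_map F p q v) = pm_map G p q (\<phi> p v)"
  using assms unfolding pm_hom_def linear_betw_def by blast+

lemma pm_homI:
  assumes "\<And>p v. p \<in> P \<Longrightarrow> v \<in> pm_space F p \<Longrightarrow> \<phi> p v \<in> pm_space G p"
    and "\<And>p u v. p \<in> P \<Longrightarrow> u \<in> pm_space F p \<Longrightarrow> v \<in> pm_space F p \<Longrightarrow> \<phi> p (u + v) = \<phi> p u + \<phi> p v"
    and "\<And>p c v. p \<in> P \<Longrightarrow> v \<in> pm_space F p \<Longrightarrow> \<phi> p (s c v) = t c (\<phi> p v)"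
    and "\<And>p q v. p \<in> P \<Longrightarrow> q \<in> P \<Longrightarrow> p \<le> q \<Longrightarrow> v \<in> pm_space F p \<Longrightarrow>
           \<phi> q (pm_map F p q v) = pm_map G p q (\<phi> p v)"
  shows "pm_hom s t P F G \<phi>"
  using assms unfolding pm_hom_def linear_betw_def by blast

lemma pm_hom_comp:
  assumes "pm_hom s t P F G \<phi>" and "pm_hom t u P G H \<psi>"
  shows "pm_hom s u P F H (\<lambda>p v. \<psi> p (\<phi> p v))"
  by (rule pm_homI) (simp_all add: pm_homD[OF assms(1)] pm_homD[OF assms(2)])

lemma pm_vector_space: "persistence_module s P F \<Longrightarrow> vector_space s"
  unfolding persistence_module_def by (rule conjunct1)

lemma pm_finite_span:
  "persistence_module s P F \<Longrightarrow> p \<in> P \<Longrightarrow> \<exists>B. finite B \<and> pm_space F p = module.span s B"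
  unfolding persistence_module_def by (elim conjE bspec)

lemma pm_subspace:
  assumes "persistence_module s P F" and "p \<in> P"
  shows "module.subspace s (pm_space F p)"
proof -
  interpret vector_space s by (rule pm_vector_space) (rule assms)
  obtain B where "pm_space F p = span B"
    using pm_finite_span[OF assms] by blast
  then show ?thesis by simp
qed

lemma pm_space_closed:
  assumes "persistence_module s P F" and "p \<in> P"
  shows "0 \<in> pm_space F p"
    and "u \<in> pm_space F p \<Longrightarrow> v \<in> pm_space F p \<Longrightarrow> u + v \<in> pm_space F p"
    and "u \<in> pm_space F p \<Longrightarrow> v \<in> pm_space F p \<Longrightarrow> u - v \<in> pm_space F p"
    and "v \<in> pm_space F p \<Longrightarrow> s c v \<in> pm_space F p"
proof -
  interpret vector_space s by (rule pm_vector_space) (rule assms)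
  note sub = pm_subspace[OF assms]
  show "0 \<in> pm_space F p"
    and "u \<in> pm_space F p \<Longrightarrow> v \<in> pm_space F p \<Longrightarrow> u + v \<in> pm_space F p"
    and "u \<in> pm_space F p \<Longrightarrow> v \<in> pm_space F p \<Longrightarrow> u - v \<in> pm_space F p"
    and "v \<in> pm_space F p \<Longrightarrow> s c v \<in> pm_space F p"
    using sub by (simp_all add: subspace_0 subspace_add subspace_diff subspace_scale)
qed

lemma pm_hom_0:
  assumes "pm_hom s t P F G \<phi>" "persistence_module s P F" "p \<in> P"
  shows "\<phi> p 0 = 0"
  using pm_homD(2)[OF assms(1,3), of 0 0] pm_space_closed(1)[OF assms(2,3)] by simp

lemma pm_hom_diff:
  assumes "pm_hom s t P F G \<phi>" "persistence_module s P F" "p \<in> P"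
    "u \<in> pm_space F p" "v \<in> pm_space F p"
  shows "\<phi> p (u - v) = \<phi> p u - \<phi> p v"
  using pm_homD(2)[OF assms(1,3), of "u - v" v] pm_space_closed(3)[OF assms(2,3)] assms(4,5)
  by (simp add: algebra_simps)

lemma pm_map_hom:
  assumes "persistence_module s P F" and "p \<in> P" "q \<in> P" "p \<le> q"
  shows "v \<in> pm_space F p \<Longrightarrow> pm_map F p q v \<in> pm_space F q"
    and "u \<in> pm_space F p \<Longrightarrow> v \<in> pm_space F p \<Longrightarrow> pm_map F p q (u + v) = pm_map F p q u + pm_map F p q v"
    and "v \<in> pm_space F p \<Longrightarrow> pm_map F p q (s c v) = s c (pm_map F p q v)"
  using assms unfolding persistence_module_def linear_betw_def by blast+

lemma pm_map_id:
  "persistence_module s P F \<Longrightarrow> p \<in> P \<Longrightarrow> v \<in> pm_space F p \<Longrightarrow> pm_map F p p v = v"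
  unfolding persistence_module_def by blast

lemma pm_map_comp:
  "persistence_module s P F \<Longrightarrow> p \<in> P \<Longrightarrow> q \<in> P \<Longrightarrow> r \<in> P \<Longrightarrow> p \<le> q \<Longrightarrow> q \<le> r \<Longrightarrow>
     v \<in> pm_space F p \<Longrightarrow> pm_map F q r (pm_map F p q v) = pm_map F p r v"
  unfolding persistence_module_def by blast

lemma pm_map_0:
  assumes "persistence_module s P F" and "p \<in> P" "q \<in> P" "p \<le> q"
  shows "pm_map F p q 0 = 0"
  using pm_map_hom(2)[OF assms, of 0 0] pm_space_closed(1)[OF assms(1,2)] by simp

lemma pm_map_diff:
  assumes "persistence_module s P F" and "p \<in> P" "q \<in> P" "p \<le> q"
    "u \<in> pm_space F p" "v \<in> pm_space F p"
  shows "pm_map F p q (u - v) = pm_map F p q u - pm_map F p q v"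
  using pm_map_hom(2)[OF assms(1-4), of "u - v" v] pm_space_closed(3)[OF assms(1,2)] assms(5,6)
  by (simp add: algebra_simps)

lemma pm_iso_inverse:
  assumes F: "persistence_module s P F" and "pm_iso s t P F G"
  obtains \<phi> \<psi> where "pm_hom s t P F G \<phi>" and "pm_hom t s P G F \<psi>"
    and "\<And>p v. p \<in> P \<Longrightarrow> v \<in> pm_space F p \<Longrightarrow> \<psi> p (\<phi> p v) = v"
    and "\<And>p w. p \<in> P \<Longrightarrow> w \<in> pm_space G p \<Longrightarrow> \<phi> p (\<psi> p w) = w"
proof -
  obtain \<phi> where hom: "pm_hom s t P F G \<phi>"
    and bij: "\<And>p. p \<in> P \<Longrightarrow> bij_betw (\<phi> p) (pm_space F p) (pm_space G p)"
    using assms(2) unfolding pm_iso_iff_bij_hom by blast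
  define \<psi> where "\<psi> = (\<lambda>p. inv_into (pm_space F p) (\<phi> p))"
  have l: "\<psi> p (\<phi> p v) = v" if "p \<in> P" "v \<in> pm_space F p" for p v
    unfolding \<psi>_def using bij[OF that(1)] that(2) by (rule bij_betw_inv_into_left)
  have r: "\<phi> p (\<psi> p w) = w" "\<psi> p w \<in> pm_space F p" if "p \<in> P" "w \<in> pm_space G p" for p w
    unfolding \<psi>_def
    using bij_betw_inv_into_right[OF bij[OF that(1)] that(2)]
      bij_betw_imp_surj_on[OF bij[OF that(1)]] that(2)
    by (auto intro: inv_into_into)
  have "pm_hom t s P G F \<psi>"
  proof (rule pm_homI)
    fix p u v assume A: "p \<in> P" "u \<in> pm_space G p" "v \<in> pm_space G p"
    have "\<psi> p (\<phi> p (\<psi> p u + \<psi> p v)) = \<psi> p u + \<psi> p v"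
      using A r by (intro l pm_space_closed(2)[OF F]) auto
    then show "\<psi> p (u + v) = \<psi> p u + \<psi> p v"
      using A r by (simp add: pm_homD(2)[OF hom])
  next
    fix p c v assume A: "p \<in> P" "v \<in> pm_space G p"
    have "\<psi> p (\<phi> p (s c (\<psi> p v))) = s c (\<psi> p v)"
      using A r by (intro l pm_space_closed(4)[OF F]) auto
    then show "\<psi> p (t c v) = s c (\<psi> p v)"
      using A r by (simp add: pm_homD(3)[OF hom])
  next
    fix p q v assume A: "p \<in> P" "q \<in> P" "p \<le> q" "v \<in> pm_space G p"
    have "\<psi> q (\<phi> q (pm_map F p q (\<psi> p v))) = pm_map F p q (\<psi> p v)"
      using A r by (intro l pm_map_hom(1)[OF F]) auto
    then show "\<psi> q (pm_map G p q v) = pm_map F p q (\<psi> p v)"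
      using A r by (simp add: pm_homD(4)[OF hom])
  qed (use r in auto)
  then show thesis using that hom l r by blast
qed

section \<open>Idempotent endomorphisms and indecomposability\<close>

text \<open>
  The image keeps the structure maps of \<open>F\<close>; it is only meant for endomorphisms \<open>e\<close> of \<open>F\<close>, for which
  naturality makes the image stable under those maps.
\<close>

definition pm_image :: "('p, 'v) pers_mod \<Rightarrow> ('p \<Rightarrow> 'v \<Rightarrow> 'v) \<Rightarrow> ('p, 'v) pers_mod" where
  "pm_image F e = \<lparr> pm_space = (\<lambda>p. e p ` pm_space F p), pm_map = pm_map F \<rparr>"

lemma pm_image_simps [simp]:
  "pm_space (pm_image F e) p = e p ` pm_space F p" "pm_map (pm_image F e) = pm_map F"
  by (simp_all add: pm_image_def)

lemma persistence_module_image: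
  assumes F: "persistence_module s P F" and e: "pm_hom s s P F F e"
  shows "persistence_module s P (pm_image F e)"
proof -
  interpret vector_space s by (rule pm_vector_space) (rule F)
  have into: "e p v \<in> pm_space F p" if "p \<in> P" "v \<in> pm_space F p" for p v
    using pm_homD(1)[OF e] that .
  show ?thesis
    unfolding persistence_module_def
  proof (intro conjI ballI impI)
    fix p assume p: "p \<in> P"
    have "subspace (e p ` pm_space F p)"
      unfolding subspace_def
    proof (intro conjI ballI allI)
      show "0 \<in> e p ` pm_space F p"
        using pm_hom_0[OF e F p] pm_space_closed(1)[OF F p] by force
    next
      fix x y assume "x \<in> e p ` pm_space F p" "y \<in> e p ` pm_space F p"
      then obtain u v where uv: "u \<in> pm_space F p" "v \<in> pm_space F p" "x = e p u" "y = e p v"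
        by blast
      then have "x + y = e p (u + v)"
        by (simp add: pm_homD(2)[OF e p])
      then show "x + y \<in> e p ` pm_space F p"
        using pm_space_closed(2)[OF F p uv(1,2)] by blast
    next
      fix c x assume "x \<in> e p ` pm_space F p"
      then obtain u where u: "u \<in> pm_space F p" "x = e p u"
        by blast
      then have "s c x = e p (s c u)"
        by (simp add: pm_homD(3)[OF e p])
      then show "s c x \<in> e p ` pm_space F p"
        using pm_space_closed(4)[OF F p u(1)] by blast
    qed
    moreover obtain B where "finite B" "pm_space F p = span B"
      using pm_finite_span[OF F p] by blast
    ultimately show "\<exists>B. finite B \<and> pm_space (pm_image F e) p = span B"
      using subspace_of_span_finite[of B "e p ` pm_space F p"] into[OF p] by auto
  next
    fix p q assume pq: "p \<in> P" "q \<in> P" "p \<le> q"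
    have "pm_map F p q (e p v) \<in> e q ` pm_space F q" if "v \<in> pm_space F p" for v
      using pm_homD(4)[OF e pq(1) pq(2,3) that] pm_map_hom(1)[OF F pq that] by (metis image_eqI)
    then show "linear_betw s s (pm_space (pm_image F e) p) (pm_space (pm_image F e) q)
        (pm_map (pm_image F e) p q)"
      using into[OF pq(1)] pm_map_hom[OF F pq] by (auto simp: linear_betw_def)
  next
    fix p v assume "p \<in> P" "v \<in> pm_space (pm_image F e) p"
    then show "pm_map (pm_image F e) p p v = v"
      using into pm_map_id[OF F] by auto
  next
    fix p q r v assume "p \<in> P" "q \<in> P" "r \<in> P" "p \<le> q" "q \<le> r" "v \<in> pm_space (pm_image F e) p"
    moreover from this have "v \<in> pm_space F p" using into by auto
    ultimately show "pm_map (pm_image F e) q r (pm_map (pm_image F e) p q v) = pm_map (pm_image F e) p r v"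
      by (simp add: pm_map_comp[OF F])
  qed (rule vector_space_axioms)
qed

lemma pm_hom_complement:
  assumes F: "persistence_module s P F" and e: "pm_hom s s P F F e"
  shows "pm_hom s s P F F (\<lambda>p v. v - e p v)"
proof -
  interpret vector_space s by (rule pm_vector_space) (rule F)
  show ?thesis
    by (rule pm_homI)
      (simp_all add: pm_space_closed[OF F] pm_homD[OF e] pm_map_diff[OF F] scale_right_diff_distrib)
qed

text \<open>
  Every element decomposes as \<open>v = e v + (v - e v)\<close>, and addition is the inverse of the map
  \<open>v \<mapsto> (e v, v - e v)\<close>, since \<open>e\<close> fixes its image and annihilates that of \<open>v \<mapsto> v - e v\<close>.
\<close>

lemma pm_iso_idempotent_split:
  assumes F: "persistence_module s P F" and e: "pm_hom s s P F F e"
    and idem: "\<And>p v. p \<in> P \<Longrightarrow> v \<in> pm_space F p \<Longrightarrow> e p (e p v) = e p v"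
  shows "pm_iso s (prod_scale s s) P F (pm_sum2 (pm_image F e) (pm_image F (\<lambda>p v. v - e p v)))"
proof -
  interpret vector_space s by (rule pm_vector_space) (rule F)
  let ?G = "pm_sum2 (pm_image F e) (pm_image F (\<lambda>p v. v - e p v))"
  let ?\<phi> = "\<lambda>p v. (e p v, v - e p v)"
  have "pm_hom s (prod_scale s s) P F ?G ?\<phi>"
    by (rule pm_homI)
      (simp_all add: pm_sum2_def prod_scale_def pm_homD[OF e] pm_map_diff[OF F] scale_right_diff_distrib)
  moreover have "bij_betw (?\<phi> p) (pm_space F p) (pm_space ?G p)" if p: "p \<in> P" for p
  proof (rule bij_betwI[where g = "\<lambda>(a, b). a + b"])
    show "?\<phi> p \<in> pm_space F p \<rightarrow> pm_space ?G p" by (auto simp: pm_sum2_def)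
    show "(\<lambda>(a, b). a + b) \<in> pm_space ?G p \<rightarrow> pm_space F p"
      using p by (auto simp: pm_sum2_def pm_space_closed[OF F] pm_homD[OF e])
  next
    fix y assume "y \<in> pm_space ?G p"
    then obtain a b where ab: "a \<in> pm_space F p" "b \<in> pm_space F p" "y = (e p a, b - e p b)"
      by (auto simp: pm_sum2_def)
    then have "e p (e p a + (b - e p b)) = e p a"
      using p by (simp add: pm_space_closed[OF F] pm_homD[OF e] pm_hom_diff[OF e F] idem)
    then show "?\<phi> p (case y of (a, b) \<Rightarrow> a + b) = y"
      using ab by simp
  qed auto
  ultimately show ?thesis unfolding pm_iso_iff_bij_hom by blast
qed

text \<open>
  An idempotent splits its module into the images of \<open>e\<close> and of the complementary idempotent, so one of
  the two images vanishes.
\<close>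

lemma indecomposable_idempotent:
  assumes F: "persistence_module s P F" "pm_indecomposable s P F" and e: "pm_hom s s P F F e"
    and idem: "\<And>p v. p \<in> P \<Longrightarrow> v \<in> pm_space F p \<Longrightarrow> e p (e p v) = e p v"
  shows "(\<forall>p\<in>P. \<forall>v\<in>pm_space F p. e p v = 0) \<or> (\<forall>p\<in>P. \<forall>v\<in>pm_space F p. e p v = v)"
proof -
  have "pm_zero P (pm_image F e) \<or> pm_zero P (pm_image F (\<lambda>p v. v - e p v))"
    using F(2)[unfolded pm_indecomposable_def, rule_format]
      persistence_module_image[OF F(1) e]
      persistence_module_image[OF F(1) pm_hom_complement[OF F(1) e]]
      pm_iso_idempotent_split[OF F(1) e idem] .
  then show ?thesis
  proof
    assume "pm_zero P (pm_image F e)"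
    then have "\<forall>p\<in>P. \<forall>v\<in>pm_space F p. e p v = 0"
      unfolding pm_zero_def pm_image_simps by blast
    then show ?thesis ..
  next
    assume "pm_zero P (pm_image F (\<lambda>p v. v - e p v))"
    then have "\<forall>p\<in>P. \<forall>v\<in>pm_space F p. v - e p v = 0"
      unfolding pm_zero_def pm_image_simps by blast
    then show ?thesis by auto
  qed
qed

text \<open>
  The converse direction: the idempotent is the projection to the first summand, transported along the
  isomorphism with the direct sum.
\<close>

lemma decomposable_idempotent:
  assumes F: "persistence_module s P F" "\<not> pm_indecomposable s P F"
  obtains e where "pm_hom s s P F F e"
    and "\<And>p v. p \<in> P \<Longrightarrow> v \<in> pm_space F p \<Longrightarrow> e p (e p v) = e p v"
    and "\<exists>p\<in>P. \<exists>v\<in>pm_space F p. e p v \<noteq> 0" and "\<exists>p\<in>P. \<exists>v\<in>pm_space F p. e p v \<noteq> v"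
proof -
  obtain F1 F2 where F12: "persistence_module s P F1" "persistence_module s P F2"
    and iso: "pm_iso s (prod_scale s s) P F (pm_sum2 F1 F2)"
    and nz: "\<not> pm_zero P F1" "\<not> pm_zero P F2"
    using F(2) unfolding pm_indecomposable_def by blast
  interpret vector_space s by (rule pm_vector_space) (rule F)
  let ?S = "pm_sum2 F1 F2"
  obtain \<phi> \<psi> where \<phi>: "pm_hom s (prod_scale s s) P F ?S \<phi>"
    and \<psi>: "pm_hom (prod_scale s s) s P ?S F \<psi>"
    and l: "\<And>p v. p \<in> P \<Longrightarrow> v \<in> pm_space F p \<Longrightarrow> \<psi> p (\<phi> p v) = v"
    and r: "\<And>p w. p \<in> P \<Longrightarrow> w \<in> pm_space ?S p \<Longrightarrow> \<phi> p (\<psi> p w) = w"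
    by (rule pm_iso_inverse[OF F(1) iso]) (rule that)
  define e where "e = (\<lambda>p v. \<psi> p (fst (\<phi> p v), 0))"
  have sp: "pm_space ?S p = pm_space F1 p \<times> pm_space F2 p" for p
    by (simp add: pm_sum2_def)
  have "pm_hom (prod_scale s s) (prod_scale s s) P ?S ?S (\<lambda>p v. (fst v, 0))"
    by (rule pm_homI)
      (auto simp: pm_sum2_def prod_scale_def pm_space_closed(1)[OF F12(2)] pm_map_0[OF F12(2)])
  then have hom: "pm_hom s s P F F e"
    unfolding e_def by (intro pm_hom_comp[OF pm_hom_comp[OF \<phi>] \<psi>])
  have mem: "(a, 0) \<in> pm_space ?S p" if "p \<in> P" "a \<in> pm_space F1 p" for p a
    using that by (simp add: sp pm_space_closed(1)[OF F12(2)])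
  have fst: "fst (\<phi> p v) \<in> pm_space F1 p" if "p \<in> P" "v \<in> pm_space F p" for p v
    using pm_homD(1)[OF \<phi> that] by (auto simp: sp)
  have idem: "e p (e p v) = e p v" if "p \<in> P" "v \<in> pm_space F p" for p v
    using that by (simp add: e_def r mem fst)
  have \<phi>0: "\<phi> p 0 = 0" if "p \<in> P" for p
    using pm_hom_0[OF \<phi> F(1) that] .
  obtain p a where "p \<in> P" "a \<in> pm_space F1 p" "a \<noteq> 0"
    using nz(1) pm_space_closed(1)[OF F12(1)] unfolding pm_zero_def by blast
  moreover from this have "e p (\<psi> p (a, 0)) = \<psi> p (a, 0)" "\<psi> p (a, 0) \<noteq> 0"
    using r[of p "(a, 0)"] \<phi>0[of p] mem by (auto simp: e_def zero_prod_def)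
  moreover from calculation have "\<psi> p (a, 0) \<in> pm_space F p"
    using pm_homD(1)[OF \<psi>] mem by blast
  ultimately have nz1: "\<exists>p\<in>P. \<exists>v\<in>pm_space F p. e p v \<noteq> 0"
    by metis
  obtain p b where b: "p \<in> P" "b \<in> pm_space F2 p" "b \<noteq> 0"
    using nz(2) pm_space_closed(1)[OF F12(2)] unfolding pm_zero_def by blast
  then have mb: "(0, b) \<in> pm_space ?S p" "0 \<in> pm_space F1 p"
    using pm_space_closed(1)[OF F12(1)] by (auto simp: sp)
  have "e p (\<psi> p (0, b)) \<noteq> \<psi> p (0, b)"
  proof
    assume "e p (\<psi> p (0, b)) = \<psi> p (0, b)"
    then have "\<phi> p (\<psi> p (0, 0)) = \<phi> p (\<psi> p (0, b))"
      using b mb by (simp add: e_def r)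
    then show False using b mb mem by (simp add: r)
  qed
  then have nid: "\<exists>p\<in>P. \<exists>v\<in>pm_space F p. e p v \<noteq> v"
    using pm_homD(1)[OF \<psi> b(1) mb(1)] b(1) by blast
  show thesis by (rule that[OF hom _ nz1 nid]) (rule idem)
qed

section \<open>Existence of indecomposable decompositions\<close>

lemma pm_iso_trans:
  assumes "pm_iso s t P F G" and "pm_iso t u P G H"
  shows "pm_iso s u P F H"
proof -
  obtain \<phi> where \<phi>: "pm_hom s t P F G \<phi>" "\<And>p. p \<in> P \<Longrightarrow> bij_betw (\<phi> p) (pm_space F p) (pm_space G p)"
    using assms(1) unfolding pm_iso_iff_bij_hom by blast
  obtain \<psi> where \<psi>: "pm_hom t u P G H \<psi>" "\<And>p. p \<in> P \<Longrightarrow> bij_betw (\<psi> p) (pm_space G p) (pm_space H p)"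
    using assms(2) unfolding pm_iso_iff_bij_hom by blast
  have "bij_betw (\<lambda>v. \<psi> p (\<phi> p v)) (pm_space F p) (pm_space H p)" if "p \<in> P" for p
    using bij_betw_trans[OF \<phi>(2)[OF that] \<psi>(2)[OF that]] by (simp add: comp_def)
  then show ?thesis
    using pm_hom_comp[OF \<phi>(1) \<psi>(1)] unfolding pm_iso_iff_bij_hom by blast
qed

lemma pm_iso_sum2:
  assumes "pm_iso s t P F F'" and "pm_iso s t P G G'"
  shows "pm_iso (prod_scale s s) (prod_scale t t) P (pm_sum2 F G) (pm_sum2 F' G')"
proof -
  obtain \<phi> where \<phi>: "pm_hom s t P F F' \<phi>" "\<And>p. p \<in> P \<Longrightarrow> bij_betw (\<phi> p) (pm_space F p) (pm_space F' p)"
    using assms(1) unfolding pm_iso_iff_bij_hom by blast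
  obtain \<psi> where \<psi>: "pm_hom s t P G G' \<psi>" "\<And>p. p \<in> P \<Longrightarrow> bij_betw (\<psi> p) (pm_space G p) (pm_space G' p)"
    using assms(2) unfolding pm_iso_iff_bij_hom by blast
  let ?\<chi> = "\<lambda>p. map_prod (\<phi> p) (\<psi> p)"
  have "pm_hom (prod_scale s s) (prod_scale t t) P (pm_sum2 F G) (pm_sum2 F' G') ?\<chi>"
    by (rule pm_homI) (auto simp: pm_sum2_def prod_scale_def pm_homD[OF \<phi>(1)] pm_homD[OF \<psi>(1)])
  moreover have "bij_betw (?\<chi> p) (pm_space (pm_sum2 F G) p) (pm_space (pm_sum2 F' G') p)"
    if "p \<in> P" for p
    using \<phi>(2)[OF that] \<psi>(2)[OF that] by (auto simp: pm_sum2_def bij_betw_def map_prod_inj_on map_prod_surj_on)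
  ultimately show ?thesis unfolding pm_iso_iff_bij_hom by blast
qed

lemma pm_iso_sum_append:
  "pm_iso (prod_scale (fun_scale s) (fun_scale s)) (fun_scale s) P
     (pm_sum2 (pm_sum Fs) (pm_sum Gs)) (pm_sum (Fs @ Gs))"
proof -
  let ?n = "length Fs"
  let ?S = "pm_sum2 (pm_sum Fs) (pm_sum Gs)" and ?T = "pm_sum (Fs @ Gs)"
  let ?\<phi> = "\<lambda>_ v i. if i < ?n then fst v i else snd v (i - ?n)"
  let ?\<psi> = "\<lambda>v. (\<lambda>i. if i < ?n then v i else 0, \<lambda>i. v (i + ?n))"
  have into: "?\<phi> p v \<in> pm_space ?T p" if "v \<in> pm_space ?S p" for p v
    unfolding pm_sum_def pers_mod.simps mem_Collect_eq
  proof
    fix i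
    show "if i < length (Fs @ Gs) then ?\<phi> p v i \<in> pm_space ((Fs @ Gs) ! i) p else ?\<phi> p v i = 0"
      using that by (cases "i < ?n") (auto simp: pm_sum_def pm_sum2_def nth_append dest: spec[of _ "i - ?n"] spec[of _ i])
  qed
  have "pm_hom (prod_scale (fun_scale s) (fun_scale s)) (fun_scale s) P ?S ?T ?\<phi>"
    using into
    by (intro pm_homI)
      (auto simp: prod_scale_def fun_scale_def pm_sum2_def pm_sum_def nth_append fun_eq_iff)
  moreover have "bij_betw (?\<phi> p) (pm_space ?S p) (pm_space ?T p)" for p
  proof (rule bij_betwI[where g = ?\<psi>])
    show "?\<phi> p \<in> pm_space ?S p \<rightarrow> pm_space ?T p"
      using into by blast
    show "?\<psi> \<in> pm_space ?T p \<rightarrow> pm_space ?S p"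
    proof
      fix v assume v: "v \<in> pm_space ?T p"
      then have v': "if i < length (Fs @ Gs) then v i \<in> pm_space ((Fs @ Gs) ! i) p else v i = 0" for i
        by (simp add: pm_sum_def)
      have left: "v i \<in> pm_space (Fs ! i) p" if "i < ?n" for i
        using v'[of i] that by (simp add: nth_append)
      have right: "if i < length Gs then v (i + ?n) \<in> pm_space (Gs ! i) p else v (i + ?n) = 0" for i
        using v'[of "i + ?n"] by (simp add: nth_append split: if_splits)
      show "?\<psi> v \<in> pm_space ?S p"
        using left right by (simp add: pm_sum_def pm_sum2_def)
    qed
  next
    fix v assume "v \<in> pm_space ?S p"
    then have "fst v i = 0" if "\<not> i < ?n" for i
      using that by (auto simp: pm_sum_def pm_sum2_def)
    then show "?\<psi> (?\<phi> p v) = v"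
      by (auto simp: prod_eq_iff)
  qed auto
  ultimately show ?thesis unfolding pm_iso_iff_bij_hom by blast
qed

lemma pm_iso_sum_singleton:
  assumes "persistence_module s P F"
  shows "pm_iso s (fun_scale s) P F (pm_sum [F])"
proof -
  interpret vector_space s by (rule pm_vector_space) (rule assms)
  let ?\<phi> = "\<lambda>_ v i. if i = 0 then v else 0"
  have "pm_hom s (fun_scale s) P F (pm_sum [F]) ?\<phi>"
    by (rule pm_homI) (auto simp: pm_sum_def fun_scale_def fun_eq_iff)
  moreover have "bij_betw (?\<phi> p) (pm_space F p) (pm_space (pm_sum [F]) p)" for p
    by (rule bij_betwI[where g = "\<lambda>v. v 0"]) (auto simp: pm_sum_def fun_eq_iff split: if_splits)
  ultimately show ?thesis unfolding pm_iso_iff_bij_hom by blast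
qed

lemma pm_iso_sum_Nil:
  assumes "persistence_module s P F" and "pm_zero P F"
  shows "pm_iso s (fun_scale s) P F (pm_sum [])"
proof -
  interpret vector_space s by (rule pm_vector_space) (rule assms)
  have "pm_hom s (fun_scale s) P F (pm_sum []) (\<lambda>_ _ _. 0)"
    by (rule pm_homI) (auto simp: pm_sum_def fun_scale_def fun_eq_iff)
  moreover have "bij_betw (\<lambda>_ _. 0) (pm_space F p) (pm_space (pm_sum []) p)" if "p \<in> P" for p
    using assms(2) that by (auto simp: pm_sum_def pm_zero_def bij_betw_def fun_eq_iff)
  ultimately show ?thesis unfolding pm_iso_iff_bij_hom by blast
qed

text \<open>
  The measure for the induction below: an idempotent other than the identity has a proper subspace as
  its image at some point of the poset.
\<close>

lemma sum_dim_image_less: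
  assumes P: "finite P" and F: "persistence_module s P F" and e: "pm_hom s s P F F e"
    and idem: "\<And>p v. p \<in> P \<Longrightarrow> v \<in> pm_space F p \<Longrightarrow> e p (e p v) = e p v"
    and moved: "\<exists>p\<in>P. \<exists>v\<in>pm_space F p. e p v \<noteq> v"
  shows "(\<Sum>p\<in>P. vector_space.dim s (pm_space (pm_image F e) p)) < (\<Sum>p\<in>P. vector_space.dim s (pm_space F p))"
proof -
  interpret vector_space s by (rule pm_vector_space) (rule F)
  have less: "dim (e p ` pm_space F p) < dim (pm_space F p)"
    if p: "p \<in> P" and ne: "e p ` pm_space F p \<noteq> pm_space F p" for p
  proof -
    obtain B where "finite B" "pm_space F p = span B"
      using pm_finite_span[OF F p] by blast
    moreover have "subspace (e p ` pm_space F p)"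
      using pm_subspace[OF persistence_module_image[OF F e] p] by simp
    moreover have "e p ` pm_space F p \<subset> pm_space F p"
      using ne pm_homD(1)[OF e p] by blast
    ultimately show ?thesis by (rule dim_strict_mono_of_finite_span)
  qed
  obtain p v where pv: "p \<in> P" "v \<in> pm_space F p" "e p v \<noteq> v"
    using moved by blast
  then have "v \<notin> e p ` pm_space F p"
    using idem by force
  then have "dim (e p ` pm_space F p) < dim (pm_space F p)"
    using less pv by blast
  moreover have "dim (e q ` pm_space F q) \<le> dim (pm_space F q)" if "q \<in> P" for q
    using less[OF that] by (cases "e q ` pm_space F q = pm_space F q") auto
  ultimately show ?thesis
    using pv(1) by (auto intro!: sum_strict_mono_ex1[OF P])
qed

text \<open>
  Split along nontrivial idempotents. Both parts are submodules of smaller total dimension, so the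
  process stops, and all summands stay in the ambient space of \<open>F\<close>.
\<close>

theorem exists_indecomposable_decomposition:
  assumes P: "finite P" and "persistence_module s P F"
  shows "\<exists>Fs. indecomposable_decomposition s s P F Fs"
  using assms(2)
proof (induction "\<Sum>p\<in>P. vector_space.dim s (pm_space F p)" arbitrary: F rule: less_induct)
  case less
  note F = less.prems
  consider "pm_zero P F" | "\<not> pm_zero P F" "pm_indecomposable s P F" | "\<not> pm_indecomposable s P F"
    by blast
  then show ?case
  proof cases
    case 1
    then have "indecomposable_decomposition s s P F []"
      using pm_iso_sum_Nil[OF F] by (simp add: indecomposable_decomposition_def)
    then show ?thesis ..
  next
    case 2
    then have "indecomposable_decomposition s s P F [F]"
      using pm_iso_sum_singleton[OF F] F by (simp add: indecomposable_decomposition_def)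
    then show ?thesis ..
  next
    case 3
    then obtain e where e: "pm_hom s s P F F e"
      and idem: "\<And>p v. p \<in> P \<Longrightarrow> v \<in> pm_space F p \<Longrightarrow> e p (e p v) = e p v"
      and nz: "\<exists>p\<in>P. \<exists>v\<in>pm_space F p. e p v \<noteq> 0" and nid: "\<exists>p\<in>P. \<exists>v\<in>pm_space F p. e p v \<noteq> v"
      by (rule decomposable_idempotent[OF F]) (rule that)
    let ?e = "\<lambda>p v. v - e p v"
    note e' = pm_hom_complement[OF F e]
    have idem': "?e p (?e p v) = ?e p v" if "p \<in> P" "v \<in> pm_space F p" for p v
      using that by (simp add: pm_hom_diff[OF e F] pm_homD(1)[OF e] idem)
    have nid': "\<exists>p\<in>P. \<exists>v\<in>pm_space F p. ?e p v \<noteq> v"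
      using nz by simp
    obtain Fs where Fs: "indecomposable_decomposition s s P (pm_image F e) Fs"
      using less.hyps[OF sum_dim_image_less[OF P F e idem nid] persistence_module_image[OF F e]] by blast
    obtain Gs where Gs: "indecomposable_decomposition s s P (pm_image F ?e) Gs"
      using less.hyps[OF sum_dim_image_less[OF P F e' idem' nid'] persistence_module_image[OF F e']] by blast
    have "pm_iso s (fun_scale s) P F (pm_sum (Fs @ Gs))"
      using Fs Gs unfolding indecomposable_decomposition_def
      by (intro pm_iso_trans[OF pm_iso_idempotent_split[OF F e idem]]
          pm_iso_trans[OF pm_iso_sum2 pm_iso_sum_append]) auto
    then have "indecomposable_decomposition s s P F (Fs @ Gs)"
      using Fs Gs unfolding indecomposable_decomposition_def set_append by blast
    then show ?thesis ..
  qed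
qed

section \<open>Interval summands detected by dual families of morphisms\<close>

lemma interval_module_simps [simp]:
  "pm_space (interval_module I) p = (if p \<in> I then UNIV else {0})"
  "pm_map (interval_module I) p q v = (if p \<in> I \<and> q \<in> I then v else 0)"
  by (simp_all add: interval_module_def)

lemma poset_interval_subset:
  assumes "poset_interval P I"
  shows "I \<subseteq> P" and "I \<noteq> {}"
  using assms unfolding poset_interval_def by auto

text \<open>
  An endomorphism of an interval module is a scalar: naturality equates its values at comparable
  points, and an interval is connected through comparable points.
\<close>

lemma interval_endo_const:
  assumes I: "poset_interval P I"
    and \<theta>: "pm_hom (*) (*) P (interval_module I) (interval_module I :: ('p::order, 'k::field) pers_mod) \<theta>"
    and pq: "p \<in> I" "q \<in> I"
  shows "\<theta> p 1 = \<theta> q 1"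
proof -
  note IP = poset_interval_subset(1)[OF I]
  have up: "\<theta> a 1 = \<theta> b 1" if "a \<in> I" "b \<in> I" "a \<le> b" for a b
    using pm_homD(4)[OF \<theta>, of a b 1] that subsetD[OF IP] by simp
  have "(p, q) \<in> {(a, b). a \<in> I \<and> b \<in> I \<and> (a \<le> b \<or> b \<le> a)}\<^sup>*"
    using I pq unfolding poset_interval_def by blast
  then show ?thesis
  proof (induction rule: rtrancl_induct)
    case (step a b)
    then have "a \<in> I" "b \<in> I" "a \<le> b \<or> b \<le> a" by simp_all
    then have "\<theta> a 1 = \<theta> b 1" using up by metis
    then show ?case using step.IH by simp
  qed simp
qed

lemma interval_hom_apply:
  assumes "pm_hom (*) t P (interval_module I) G \<phi>" "p \<in> P" "p \<in> I"
  shows "\<phi> p x = t x (\<phi> p 1)"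
  using pm_homD(3)[OF assms(1,2), of 1 x] assms(3) by simp

text \<open>
  The composite \<open>g \<circ> f\<close> is a nonzero scalar \<open>c\<close>, so \<open>e = inverse c * (f \<circ> g)\<close> is a nonzero idempotent
  of \<open>F\<close>. Indecomposability makes it the identity, and then \<open>f\<close> and \<open>g\<close> are inverse to each other up to \<open>c\<close>.
\<close>

lemma indecomposable_factor_interval:
  fixes F :: "('p::order, 'v::ab_group_add) pers_mod" and s :: "'k::field \<Rightarrow> 'v \<Rightarrow> 'v"
  assumes F: "persistence_module s P F" "pm_indecomposable s P F" and I: "poset_interval P I"
    and f: "pm_hom (*) s P (interval_module I) F f" and g: "pm_hom s (*) P F (interval_module I) g"
    and p0: "p0 \<in> I" "g p0 (f p0 1) \<noteq> 0"
  shows "pm_iso s (*) P F (interval_module I)"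
proof -
  define c where "c = g p0 (f p0 1)"
  note IP = poset_interval_subset(1)[OF I]
  note gf = pm_hom_comp[OF f g]
  have gf_scale: "g p (f p x) = x * c" if "p \<in> I" for p x
    using interval_hom_apply[OF gf, of p x] interval_endo_const[OF I gf that p0(1)] that IP
    by (auto simp: c_def)
  have f0: "f p 0 = 0" if "p \<in> P" for p
    by (rule pm_hom_0[OF f persistence_module_interval[OF I] that])
  have g0: "g p 0 = 0" if "p \<in> P" for p
    by (rule pm_hom_0[OF g F(1) that])
  have g_out: "g p v = 0" if "p \<in> P" "p \<notin> I" "v \<in> pm_space F p" for p v
    using pm_homD(1)[OF g that(1,3)] that(2) by simp
  define e where "e = (\<lambda>p v. f p (inverse c * g p v))"
  have "pm_hom (*) (*) P (interval_module I) (interval_module I :: ('p, 'k) pers_mod) (\<lambda>p v. inverse c * v)"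
    by (rule pm_homI) (auto simp: algebra_simps)
  then have e: "pm_hom s s P F F e"
    unfolding e_def by (intro pm_hom_comp[OF pm_hom_comp[OF g] f])
  have c0: "c \<noteq> 0" using p0 by (simp add: c_def)
  have g_e: "g p (e p v) = g p v" if "p \<in> P" "v \<in> pm_space F p" for p v
    using that c0 gf_scale g_out f0 g0 by (cases "p \<in> I") (simp_all add: e_def)
  then have idem: "e p (e p v) = e p v" if "p \<in> P" "v \<in> pm_space F p" for p v
    using that unfolding e_def by simp
  have f_mem: "f p0 1 \<in> pm_space F p0"
    using pm_homD(1)[OF f] p0(1) IP by auto
  have "e p0 (f p0 1) \<noteq> 0"
    using g_e[OF _ f_mem] p0 g0[of p0] IP by (metis subsetD)
  then have e_id: "e p v = v" if "p \<in> P" "v \<in> pm_space F p" for p v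
    using indecomposable_idempotent[OF F e idem] f_mem p0(1) IP that by blast
  have "bij_betw (g p) (pm_space F p) (pm_space (interval_module I) p)" if p: "p \<in> P" for p
  proof (rule bij_betwI[where g = "\<lambda>x. f p (inverse c * x)"])
    show "g p \<in> pm_space F p \<rightarrow> pm_space (interval_module I) p"
      using pm_homD(1)[OF g p] by blast
    show "(\<lambda>x. f p (inverse c * x)) \<in> pm_space (interval_module I) p \<rightarrow> pm_space F p"
    proof
      fix x :: 'k assume "x \<in> pm_space (interval_module I) p"
      then show "f p (inverse c * x) \<in> pm_space F p"
        by (intro pm_homD(1)[OF f p]) (auto split: if_splits)
    qed
    show "f p (inverse c * g p v) = v" if "v \<in> pm_space F p" for v
      using e_id[OF p that] by (simp add: e_def)
    show "g p (f p (inverse c * x)) = x" if "x \<in> pm_space (interval_module I) p" for x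
      using that gf_scale[of p "inverse c * x"] c0 f0[OF p] g0[OF p] by (auto split: if_splits)
  qed
  then show ?thesis using g unfolding pm_iso_iff_bij_hom by blast
qed

text \<open>
  The points outside the support are those where the space has exactly one element.
\<close>

lemma interval_module_iso_unique:
  assumes "I \<subseteq> P" "J \<subseteq> P"
    and "pm_iso s (*) P F (interval_module I :: ('p::order, 'k::field) pers_mod)"
    and "pm_iso s (*) P F (interval_module J :: ('p, 'k) pers_mod)"
  shows "I = J"
proof -
  have one: "(\<exists>x. pm_space F p = {x}) \<longleftrightarrow> p \<notin> L"
    if iso: "pm_iso s (*) P F (interval_module L :: ('p, 'k) pers_mod)" and p: "p \<in> P" for L p
  proof -
    obtain \<phi> where "bij_betw (\<phi> p) (pm_space F p) (pm_space (interval_module L :: ('p, 'k) pers_mod) p)"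
      using iso p unfolding pm_iso_iff_bij_hom by blast
    then have "card (pm_space F p) = card (pm_space (interval_module L :: ('p, 'k) pers_mod) p)"
      by (rule bij_betw_same_card)
    moreover have "card (UNIV :: 'k set) \<noteq> 1"
      by (metis (full_types) UNIV_I card_1_singletonE singletonD zero_neq_one)
    ultimately have "card (pm_space F p) = 1 \<longleftrightarrow> p \<notin> L"
      by auto
    then show ?thesis by (simp add: card_1_singleton_iff)
  qed
  have "p \<in> I \<longleftrightarrow> p \<in> J" if "p \<in> P" for p
    using one[OF assms(3) that] one[OF assms(4) that] by simp
  then show ?thesis
    using assms(1,2) by blast
qed

lemma pm_hom_sum_component:
  assumes "i < length Fs"
  shows "pm_hom (fun_scale s) s P (pm_sum Fs) (Fs ! i) (\<lambda>p v. v i)"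
  using assms by (intro pm_homI) (auto simp: pm_sum_def fun_scale_def)

lemma pm_hom_sum_inclusion:
  assumes Fs: "\<And>G. G \<in> set Fs \<Longrightarrow> persistence_module s P G" and i: "i < length Fs"
  shows "pm_hom s (fun_scale s) P (Fs ! i) (pm_sum Fs) (\<lambda>p v j. if j = i then v else 0)"
proof -
  interpret vector_space s
    by (rule pm_vector_space[OF Fs]) (rule nth_mem[OF i])
  have pm: "persistence_module s P (Fs ! j)" if "j < length Fs" for j
    using Fs that by simp
  show ?thesis
    using i
    by (intro pm_homI)
      (auto simp: pm_sum_def fun_scale_def fun_eq_iff pm_space_closed(1)[OF pm] pm_map_0[OF pm])
qed

text \<open>
  An element of a finite direct sum is the sum of its components, and a morphism is additive. The
  induction runs over the truncations of \<open>v\<close>, which remain in the direct sum.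
\<close>

lemma pm_hom_sum_expand:
  assumes Fs: "\<And>G. G \<in> set Fs \<Longrightarrow> persistence_module s P G"
    and \<phi>: "pm_hom (fun_scale s) t P (pm_sum Fs) H \<phi>" and p: "p \<in> P" and v: "v \<in> pm_space (pm_sum Fs) p"
  shows "\<phi> p v = (\<Sum>i<length Fs. \<phi> p (\<lambda>j. if j = i then v i else 0))"
proof -
  define S where "S = (\<lambda>i j. if j = i then v i else 0)"
  define T where "T = (\<lambda>m j. if j < m then v j else 0)"
  have pm: "persistence_module s P (Fs ! j)" if "j < length Fs" for j
    using Fs that by simp
  have mem: "T m \<in> pm_space (pm_sum Fs) p" "S m \<in> pm_space (pm_sum Fs) p" for m
    using v pm_space_closed(1)[OF pm p] by (auto simp: pm_sum_def S_def T_def)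
  have "\<phi> p (T m) = (\<Sum>i<m. \<phi> p (S i))" for m
  proof (induction m)
    case 0
    have "T 0 = 0" by (simp add: T_def fun_eq_iff)
    then show ?case
      using pm_homD(2)[OF \<phi> p mem(1) mem(1), of 0 0] by (simp del: zero_fun_apply)
  next
    case (Suc m)
    have "T (Suc m) = T m + S m"
      by (auto simp: T_def S_def fun_eq_iff less_Suc_eq)
    then have "\<phi> p (T (Suc m)) = \<phi> p (T m + S m)"
      by (rule arg_cong)
    also have "\<dots> = \<phi> p (T m) + \<phi> p (S m)"
      by (rule pm_homD(2)[OF \<phi> p mem])
    finally show ?case using Suc.IH by simp
  qed
  moreover have "T (length Fs) = v"
    using v by (auto simp: T_def pm_sum_def fun_eq_iff)
  ultimately have "\<phi> p v = (\<Sum>i<length Fs. \<phi> p (S i))"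
    by metis
  then show ?thesis unfolding S_def .
qed

text \<open>
  The rank comparison behind the main inequality. For each summand \<open>F\<^sub>i\<close>, consider the matrix whose
  \<open>(c', c)\<close> entry is the scalar of \<open>I c \<rightarrow> F \<rightarrow> F\<^sub>i \<rightarrow> F \<rightarrow> I c'\<close> if \<open>I c = I c'\<close>, and \<open>0\<close> otherwise. By the
  duality hypothesis these matrices add up to the identity. A nonzero entry makes \<open>F\<^sub>i\<close> isomorphic to
  the interval module on \<open>I c\<close>, and then the matrix has rank one, since each of its entries is a product
  of a scalar endomorphism \<open>I c \<rightarrow> F\<^sub>i \<cong> I c\<close> with a scalar endomorphism \<open>I c' \<cong> F\<^sub>i \<rightarrow> I c'\<close>. So at least
  \<open>card C\<close> of the summands are intervals.
\<close>

theorem card_le_interval_summands: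
  fixes F :: "('p::order, 'v::ab_group_add) pers_mod" and Fs :: "('p, 'w::ab_group_add) pers_mod list"
    and s :: "'k::field \<Rightarrow> 'w \<Rightarrow> 'w" and t :: "'k \<Rightarrow> 'v \<Rightarrow> 'v" and I :: "'c \<Rightarrow> 'p set"
  assumes F: "persistence_module t P F" and dec: "indecomposable_decomposition t s P F Fs"
    and C: "finite C"
    and I: "\<And>c. c \<in> C \<Longrightarrow> poset_interval P (I c)"
    and a: "\<And>c. c \<in> C \<Longrightarrow> pm_hom (*) t P (interval_module (I c)) F (a c)"
    and b: "\<And>c. c \<in> C \<Longrightarrow> pm_hom t (*) P F (interval_module (I c)) (b c)"
    and dual: "\<And>c c' p. c \<in> C \<Longrightarrow> c' \<in> C \<Longrightarrow> I c = I c' \<Longrightarrow> p \<in> I c \<Longrightarrow>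
           b c' p (a c p 1) = (if c' = c then 1 else 0)"
  shows "card C \<le> length (filter (is_interval_module s P) Fs)"
proof -
  have Fs: "persistence_module s P G" "pm_indecomposable s P G" if "G \<in> set Fs" for G
    using dec that unfolding indecomposable_decomposition_def by blast+
  obtain h k where h: "pm_hom t (fun_scale s) P F (pm_sum Fs) h"
    and k: "pm_hom (fun_scale s) t P (pm_sum Fs) F k"
    and kh: "\<And>p v. p \<in> P \<Longrightarrow> v \<in> pm_space F p \<Longrightarrow> k p (h p v) = v"
    by (rule pm_iso_inverse[OF F dec[unfolded indecomposable_decomposition_def, THEN conjunct2]])
      (rule that)
  \<comment> \<open>\<open>A i c\<close> and \<open>B i c\<close> are \<open>a c\<close> followed by the projection to the summand \<open>i\<close>, and \<open>b c\<close>
    restricted to that summand.\<close>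
  define A where "A = (\<lambda>i c p x. h p (a c p x) i)"
  define B where "B = (\<lambda>i c p v. b c p (k p (\<lambda>j. if j = i then v else 0)))"
  have A: "pm_hom (*) s P (interval_module (I c)) (Fs ! i) (A i c)"
    if "i < length Fs" "c \<in> C" for i c
    unfolding A_def
    by (rule pm_hom_comp[OF pm_hom_comp[OF a[OF that(2)] h] pm_hom_sum_component[OF that(1)]])
  have B: "pm_hom s (*) P (Fs ! i) (interval_module (I c)) (B i c)"
    if "i < length Fs" "c \<in> C" for i c
    unfolding B_def
    by (rule pm_hom_comp[OF pm_hom_comp[OF pm_hom_sum_inclusion[OF Fs(1) that(1)] k] b[OF that(2)]])
  define J where "J = {i. i < length Fs \<and> is_interval_module s P (Fs ! i)}"
  have "\<forall>i\<in>J. \<exists>K. poset_interval P K \<and> pm_iso s (*) P (Fs ! i) (interval_module K)"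
    by (simp add: J_def is_interval_module_def)
  then obtain K where K: "\<And>i. i \<in> J \<Longrightarrow> poset_interval P (K i)"
    and Kiso: "\<And>i. i \<in> J \<Longrightarrow> pm_iso s (*) P (Fs ! i) (interval_module (K i))"
    by metis
  have "\<exists>\<phi> \<psi>. pm_hom s (*) P (Fs ! i) (interval_module (K i)) \<phi> \<and>
      pm_hom (*) s P (interval_module (K i)) (Fs ! i) \<psi> \<and>
      (\<forall>p\<in>P. \<forall>v\<in>pm_space (Fs ! i) p. \<psi> p (\<phi> p v) = v)" if i: "i \<in> J" for i
  proof -
    have "persistence_module s P (Fs ! i)" using i Fs by (simp add: J_def)
    from pm_iso_inverse[OF this Kiso[OF i]] show ?thesis by metis
  qed
  then obtain \<Phi> \<Psi> where \<Phi>: "\<And>i. i \<in> J \<Longrightarrow> pm_hom s (*) P (Fs ! i) (interval_module (K i)) (\<Phi> i)"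
    and \<Psi>: "\<And>i. i \<in> J \<Longrightarrow> pm_hom (*) s P (interval_module (K i)) (Fs ! i) (\<Psi> i)"
    and \<Psi>\<Phi>: "\<And>i p v. i \<in> J \<Longrightarrow> p \<in> P \<Longrightarrow> v \<in> pm_space (Fs ! i) p \<Longrightarrow> \<Psi> i p (\<Phi> i p v) = v"
    by metis
  \<comment> \<open>The base point depends on the interval only, so that \<open>\<alpha>\<close> and \<open>\<beta>\<close> read off their scalars at the
    same point.\<close>
  define pt where "pt = (\<lambda>L :: 'p set. SOME p. p \<in> L)"
  define \<alpha> where "\<alpha> = (\<lambda>i c. if I c = K i then \<Phi> i (pt (K i)) (A i c (pt (K i)) 1) else 0)"
  define \<beta> where "\<beta> = (\<lambda>i c. if I c = K i then B i c (pt (K i)) (\<Psi> i (pt (K i)) 1) else 0)"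
  have "(\<Sum>i\<in>J. \<beta> i c' * \<alpha> i c) = (if c' = c then 1 else 0)" if c: "c \<in> C" "c' \<in> C" for c c'
  proof (cases "I c = I c'")
    case False
    then have "\<beta> i c' * \<alpha> i c = 0" for i
      by (cases "I c = K i") (simp_all add: \<alpha>_def \<beta>_def)
    then have "(\<Sum>i\<in>J. \<beta> i c' * \<alpha> i c) = 0"
      by (rule sum.neutral[OF ballI])
    then show ?thesis using False by auto
  next
    case same: True
    define p where "p = pt (I c)"
    have p: "p \<in> I c" "p \<in> P"
      using poset_interval_subset[OF I[OF c(1)]] some_in_eq[of "I c"]
      unfolding p_def pt_def by blast+
    have ac: "a c p 1 \<in> pm_space F p"
      using pm_homD(1)[OF a[OF c(1)] p(2)] p(1) by simp
    have summand: "B i c' p (A i c p 1) = (if i \<in> J then \<beta> i c' * \<alpha> i c else 0)"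
      if i: "i < length Fs" for i
    proof (cases "i \<in> J \<and> I c = K i")
      case True
      define x where "x = \<Phi> i p (A i c p 1)"
      have "A i c p 1 \<in> pm_space (Fs ! i) p"
        using pm_homD(1)[OF A[OF i c(1)] p(2)] p(1) by simp
      then have "B i c' p (A i c p 1) = B i c' p (\<Psi> i p x)"
        unfolding x_def using True p(2) by (simp add: \<Psi>\<Phi>)
      also have "\<dots> = x * B i c' p (\<Psi> i p 1)"
        using pm_hom_comp[OF \<Psi> B[OF i c(2)], THEN interval_hom_apply, of p x] True p by simp
      finally show ?thesis
        using True same by (simp add: \<alpha>_def \<beta>_def x_def p_def mult.commute)
    next
      case False
      have "B i c' p (A i c p 1) = 0"
      proof (rule ccontr)
        assume "B i c' p (A i c p 1) \<noteq> 0"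
        moreover have "pm_hom s (*) P (Fs ! i) (interval_module (I c)) (B i c')"
          using B[OF i c(2)] same by simp
        ultimately have iso: "pm_iso s (*) P (Fs ! i) (interval_module (I c))"
          using p(1)
          by (intro indecomposable_factor_interval[OF Fs[OF nth_mem[OF i]] I[OF c(1)] A[OF i c(1)]])
        then have iJ: "i \<in> J"
          using i I[OF c(1)] unfolding J_def is_interval_module_def by blast
        have "I c = K i"
          using poset_interval_subset(1)[OF I[OF c(1)]] poset_interval_subset(1)[OF K[OF iJ]] iso Kiso[OF iJ]
          by (rule interval_module_iso_unique)
        then show False using False iJ by simp
      qed
      then show ?thesis using False by (auto simp: \<alpha>_def)
    qed
    have "(if c' = c then 1 else 0) = b c' p (k p (h p (a c p 1)))"
      using dual[OF c same p(1)] kh[OF p(2) ac] by simp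
    also have "\<dots> = (\<Sum>i<length Fs. B i c' p (A i c p 1))"
      unfolding A_def B_def
      by (rule pm_hom_sum_expand[OF Fs(1) pm_hom_comp[OF k b[OF c(2)]] p(2) pm_homD(1)[OF h p(2) ac]])
    also have "\<dots> = (\<Sum>i<length Fs. if i \<in> J then \<beta> i c' * \<alpha> i c else 0)"
      by (intro sum.cong refl) (simp add: summand)
    also have "\<dots> = (\<Sum>i\<in>{..<length Fs} \<inter> J. \<beta> i c' * \<alpha> i c)"
      by (simp add: sum.inter_restrict)
    also have "{..<length Fs} \<inter> J = J"
      by (auto simp: J_def)
    finally show ?thesis by simp
  qed
  then have "card C \<le> card J"
    by (intro card_le_of_rank_one_sum[OF C, where \<alpha> = \<alpha> and \<beta> = \<beta>]) (auto simp: J_def)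
  then show ?thesis
    by (simp add: J_def length_filter_conv_card)
qed

section \<open>The interval summand of a pair of mutual nearest neighbors\<close>

text \<open>
  As long as the scale stays below \<open>d x y\<close>, both \<open>x\<close> and \<open>y\<close> are isolated vertices, and they share a
  component as soon as both are present and the scale reaches \<open>d x y\<close>. So the difference of the classes of
  \<open>y\<close> and \<open>x\<close> spans a copy of an interval module: it is born when \<open>y\<close> appears and dies at scale
  \<open>d x y\<close>. The coefficient of \<open>{y}\<close> is a retraction onto this copy, because nothing but \<open>{y}\<close> maps to
  an isolated \<open>{y}\<close>.
\<close>

locale mutual_nearest_neighbors = Metric_space M d for M :: "'m set" and d +
  fixes f :: "'m \<Rightarrow> real" and x y :: 'm
  assumes finite_M: "finite M" and x_in: "x \<in> M" and y_in: "y \<in> M" and neq: "x \<noteq> y"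
    and nearest_x: "\<And>z. z \<in> M \<Longrightarrow> z \<noteq> x \<Longrightarrow> d x y \<le> d x z"
    and nearest_y: "\<And>z. z \<in> M \<Longrightarrow> z \<noteq> y \<Longrightarrow> d x y \<le> d y z"
    and older: "f x \<le> f y"
begin

abbreviation "P \<equiv> density_rips_poset M d f"
abbreviation "S \<equiv> density_rips M d f"
abbreviation "E p \<equiv> rips_edges d (sublevel M f (snd p)) (fst p)"

definition support :: "(real \<times> real) set" where
  "support = {p \<in> P. fst p < d x y \<and> f y \<le> snd p}"

definition difference_class :: "real \<times> real \<Rightarrow> 'k::field \<Rightarrow> 'm set \<Rightarrow> 'k" where
  "difference_class p c C =
     (if p \<in> support then (if C = {y} then c else 0) - (if C = {x} then c else 0) else 0)"

definition coefficient :: "real \<times> real \<Rightarrow> ('m set \<Rightarrow> 'k::field) \<Rightarrow> 'k" where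
  "coefficient p v = (if p \<in> support then v {y} else 0)"

lemma ps_obj_eq: "ps_obj S p = sublevel M f (snd p) // (E p)\<^sup>*"
  by (simp add: density_rips_def split_beta)

lemma ps_map_eq: "ps_map S p q C = (E q)\<^sup>* `` C"
  by (simp add: density_rips_def split_beta)

lemma finite_obj: "finite (ps_obj S p)"
  using finite_M by (simp add: ps_obj_eq quotient_def sublevel_def)

text \<open>
  The support has the least element \<open>(0, f y)\<close>, hence is connected.
\<close>

lemma poset_interval_support: "poset_interval P support"
  unfolding poset_interval_def
proof (intro conjI ballI impI)
  show "support \<subseteq> P" by (auto simp: support_def)
  have "0 < d x y" using x_in y_in neq by simp
  moreover have "(0, f y) \<in> P"
    using y_in by (force simp: density_rips_poset_def)
  ultimately have bottom: "(0, f y) \<in> support"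
    by (simp add: support_def)
  then show "support \<noteq> {}" by blast
  fix i j assume ij: "i \<in> support" "j \<in> support"
  have least: "(0, f y) \<le> k" if "k \<in> support" for k
    using that nonneg by (auto simp: support_def less_eq_prod_def density_rips_poset_def)
  let ?R = "{(a, b). a \<in> support \<and> b \<in> support \<and> (a \<le> b \<or> b \<le> a)}"
  have "(i, (0, f y)) \<in> ?R" "((0, f y), j) \<in> ?R"
    using ij bottom least by auto
  then show "(i, j) \<in> ?R\<^sup>*" by (meson r_into_rtrancl rtrancl_trans)
next
  fix i j l assume "i \<in> support" "j \<in> support" "l \<in> P" "i \<le> l" "l \<le> j"
  then show "l \<in> support"
    by (auto simp: support_def less_eq_prod_def)
qed

lemma in_sublevel:
  assumes "f y \<le> snd p" "z \<in> {x, y}"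
  shows "z \<in> sublevel M f (snd p)"
  using assms x_in y_in older by (auto simp: sublevel_def)

lemma isolated:
  assumes p: "p \<in> support" and z: "z \<in> {x, y}"
  shows "(E p)\<^sup>* `` {z} = {z}" and "{z} \<in> ps_obj S p"
proof -
  have "w = z" if "(z, w) \<in> E p" for w
  proof (rule ccontr)
    assume "w \<noteq> z"
    then have "d x y \<le> d z w"
      using z that nearest_x nearest_y by (auto simp: rips_edges_def sublevel_def)
    then show False
      using that p by (simp add: rips_edges_def support_def)
  qed
  note edge = this
  have "w = z" if "(z, w) \<in> (E p)\<^sup>*" for w
    using that
  proof (induction rule: rtrancl_induct)
    case (step u w)
    then show ?case using edge by blast
  qed simp
  then show singleton: "(E p)\<^sup>* `` {z} = {z}" by auto
  have "z \<in> sublevel M f (snd p)"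
    using in_sublevel[of p z] z p by (simp add: support_def)
  then show "{z} \<in> ps_obj S p"
    unfolding ps_obj_eq using quotientI[of z _ "(E p)\<^sup>*"] singleton by simp
qed

lemma merged:
  assumes "d x y \<le> fst q" "f y \<le> snd q"
  shows "(E q)\<^sup>* `` {x} = (E q)\<^sup>* `` {y}"
proof -
  have "(x, y) \<in> E q" "(y, x) \<in> E q"
    using assms(1) in_sublevel[OF assms(2), of x] in_sublevel[OF assms(2), of y]
    by (auto simp: rips_edges_def commute)
  then show ?thesis
    by (auto intro: converse_rtrancl_into_rtrancl)
qed

text \<open>
  Inside the support the two components are singletons and are carried to singletons; on leaving the
  support, which is only possible by increasing the scale, they merge and the difference becomes \<open>0\<close>.
\<close>

lemma pm_hom_difference_class:
  "pm_hom (*) (fun_scale (*)) P (interval_module support)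
     (linearization S :: (real \<times> real, 'm set \<Rightarrow> 'k::field) pers_mod) difference_class"
proof (rule pm_homI)
  fix p and c :: 'k
  show "difference_class p c \<in> pm_space (linearization S) p"
    using isolated(2)[of p] by (auto simp: linearization_def difference_class_def)
next
  fix p q and c :: 'k
  assume pq: "p \<in> P" "q \<in> P" "p \<le> q" and c: "c \<in> pm_space (interval_module support) p"
  show "difference_class q (pm_map (interval_module support) p q c)
      = pm_map (linearization S) p q (difference_class p c)"
  proof (cases "p \<in> support")
    case False
    then show ?thesis
      by (simp add: difference_class_def linearization_def fun_eq_iff)
  next
    case True
    have "pm_map (linearization S) p q (difference_class p c) D
        = (if (E q)\<^sup>* `` {y} = D then c else 0) - (if (E q)\<^sup>* `` {x} = D then c else 0)" for D
      using True isolated(2)[OF True] finite_obj[of p]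
      by (simp add: linearization_def difference_class_def ps_map_eq sum_subtractf)
    moreover have "difference_class q (pm_map (interval_module support) p q c) D
        = (if (E q)\<^sup>* `` {y} = D then c else 0) - (if (E q)\<^sup>* `` {x} = D then c else 0)" for D
    proof (cases "q \<in> support")
      case q: True
      then show ?thesis
        using True isolated(1)[OF q] by (auto simp: difference_class_def)
    next
      case q: False
      then have "(E q)\<^sup>* `` {x} = (E q)\<^sup>* `` {y}"
        using True pq by (intro merged) (auto simp: support_def less_eq_prod_def)
      then show ?thesis
        using q by (simp add: difference_class_def)
    qed
    ultimately show ?thesis by (simp add: fun_eq_iff)
  qed
qed (auto simp: difference_class_def fun_scale_def fun_eq_iff algebra_simps)

text \<open>
  A component is contained in its image, so only \<open>{y}\<close> itself maps to \<open>{y}\<close>, and it is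
  present only at points of the support. This is the naturality of the coefficient of \<open>{y}\<close>.
\<close>

lemma class_to_singleton:
  assumes p: "p \<in> P" and q: "q \<in> support" and le: "p \<le> q"
  shows "{C \<in> ps_obj S p. ps_map S p q C = {y}} = (if p \<in> support then {{y}} else {})"
proof -
  have "C = {y} \<and> p \<in> support" if C: "C \<in> ps_obj S p" "(E q)\<^sup>* `` C = {y}" for C
  proof -
    obtain z where z: "z \<in> sublevel M f (snd p)" "C = (E p)\<^sup>* `` {z}"
      using C(1) unfolding ps_obj_eq by (rule quotientE)
    have sub: "C \<subseteq> (E q)\<^sup>* `` C" by blast
    have "z \<in> C" using z(2) by blast
    then have "C = {y}" "z = y" using sub C(2) by auto
    moreover have "f y \<le> snd p" using z(1) \<open>z = y\<close> by (simp add: sublevel_def)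
    ultimately show ?thesis
      using q le p by (auto simp: support_def less_eq_prod_def)
  qed
  moreover have "{y} \<in> ps_obj S p" if "p \<in> support"
    using isolated(2)[OF that, of y] by simp
  moreover have "(E q)\<^sup>* `` {y} = {y}"
    using isolated(1)[OF q, of y] by simp
  ultimately show ?thesis unfolding ps_map_eq by auto
qed

lemma pm_hom_coefficient:
  "pm_hom (fun_scale (*)) (*) P
     (linearization S :: (real \<times> real, 'm set \<Rightarrow> 'k::field) pers_mod)
     (interval_module support) coefficient"
proof (rule pm_homI)
  fix p q and v :: "'m set \<Rightarrow> 'k"
  assume pq: "p \<in> P" "q \<in> P" "p \<le> q"
  show "coefficient q (pm_map (linearization S) p q v)
      = pm_map (interval_module support) p q (coefficient p v)"
    using class_to_singleton[OF pq(1) _ pq(3)]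
    by (auto simp: coefficient_def linearization_def)
qed (auto simp: coefficient_def fun_scale_def)

text \<open>
  Each of the two families vanishes outside its own support. At a common point of the supports, the
  composite compares \<open>{y}\<close> with the two components \<open>{x'}\<close> and \<open>{y'}\<close>.
\<close>

lemma coefficient_difference_class:
  assumes "mutual_nearest_neighbors M d f x' y'"
    and "mutual_nearest_neighbors.support M d f x' y' = support" and "p \<in> support"
  shows "coefficient p (mutual_nearest_neighbors.difference_class M d f x' y' p (1 :: 'k::field))
    = (if y = y' then 1 else 0) - (if y = x' then 1 else 0)"
proof -
  interpret other: mutual_nearest_neighbors M d f x' y' by fact
  show ?thesis
    using assms(2,3) by (simp add: coefficient_def other.difference_class_def)
qed

end

section \<open>Two-cycles of the nearest neighbor graph\<close>

lemma nearest_neighbor_unique: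
  assumes "antisym r" "nearest_neighbor M d r x y" "nearest_neighbor M d r x z"
  shows "y = z"
proof -
  have "d x y = d x z"
    using assms(2,3) unfolding nearest_neighbor_def by (auto intro: order_antisym)
  then have "(y, z) \<in> r" "(z, y) \<in> r"
    using assms(2,3) unfolding nearest_neighbor_def by auto
  then show ?thesis using assms(1) by (simp add: antisym_def)
qed

text \<open>
  Ties are broken by an antisymmetric relation, so every point has at most one nearest neighbor, and a
  two-cycle is determined by any of its points.
\<close>

lemma two_cycles_disjoint:
  assumes "antisym r" and "c \<in> two_cycles (nn_edges M d r)" "c' \<in> two_cycles (nn_edges M d r)"
    and "z \<in> c" "z \<in> c'"
  shows "c = c'"
proof -
  have partner: "\<exists>w. nearest_neighbor M d r z w \<and> b = {z, w}"
    if "b \<in> two_cycles (nn_edges M d r)" "z \<in> b" for b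
    using that unfolding two_cycles_def nn_edges_def by auto
  show ?thesis
    using partner[OF assms(2,4)] partner[OF assms(3,5)] nearest_neighbor_unique[OF assms(1)] by metis
qed

text \<open>
  The point with the smaller value of \<open>f\<close> becomes \<open>x\<close>, so that \<open>x\<close> is present whenever \<open>y\<close> is.
\<close>

lemma two_cycle_orient:
  assumes "Metric_space M d" "finite M" and "c \<in> two_cycles (nn_edges M d r)"
  shows "\<exists>x y. c = {x, y} \<and> mutual_nearest_neighbors M d f x y"
proof -
  have mutual: "mutual_nearest_neighbors M d f x y"
    if "x \<in> M" "y \<in> M" "nearest_neighbor M d r x y" "nearest_neighbor M d r y x" "f x \<le> f y" for x y
  proof -
    interpret Metric_space M d by fact
    show ?thesis
      using assms(2) that commute[of y x]
      by unfold_locales (auto simp: nearest_neighbor_def)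
  qed
  obtain x y where "c = {x, y}" "x \<in> M" "y \<in> M"
    "nearest_neighbor M d r x y" "nearest_neighbor M d r y x"
    using assms(3) unfolding two_cycles_def nn_edges_def by blast
  then show ?thesis
    using mutual[of x y] mutual[of y x] insert_commute[of x y "{}"] by (metis linear)
qed

section \<open>Interval summands and two-cycles\<close>

theorem lemma5p3:
  fixes M :: "'m set" and d :: "'m \<Rightarrow> 'm \<Rightarrow> real" and f :: "'m \<Rightarrow> real"
    and r :: "'m rel"
    and s :: "'k::field \<Rightarrow> 'w::ab_group_add \<Rightarrow> 'w"
  defines "P \<equiv> density_rips_poset M d f"
    and "LS \<equiv> (linearization (density_rips M d f) :: (real \<times> real, 'm set \<Rightarrow> 'k) pers_mod)"
  assumes "Metric_space M d" and "finite M"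
    and "compatible_order M f r"
    and "vector_space s"
  shows "(\<exists>Fs :: (real \<times> real, 'm set \<Rightarrow> 'k) pers_mod list.
            indecomposable_decomposition (fun_scale (*)) (fun_scale (*)) P LS Fs) \<and>
         (\<forall>Fs :: (real \<times> real, 'w) pers_mod list.
            indecomposable_decomposition (fun_scale (*)) s P LS Fs \<longrightarrow>
            card (two_cycles (nn_edges M d r)) \<le> length (filter (is_interval_module s P) Fs))"
proof (intro conjI allI impI)
  have LS: "persistence_module (fun_scale (*)) P LS"
    unfolding P_def LS_def
    by (rule persistence_module_linearization[OF persistent_set_density_rips[OF assms(4)]])
  have "finite P"
    unfolding P_def density_rips_poset_def using assms(4) by (simp add: finite_image_set2)
  then show "\<exists>Fs :: (real \<times> real, 'm set \<Rightarrow> 'k) pers_mod list.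
      indecomposable_decomposition (fun_scale (*)) (fun_scale (*)) P LS Fs"
    using LS by (rule exists_indecomposable_decomposition)
  fix Fs :: "(real \<times> real, 'w) pers_mod list"
  assume Fs: "indecomposable_decomposition (fun_scale (*)) s P LS Fs"
  let ?C = "two_cycles (nn_edges M d r)"
  have "\<forall>c\<in>?C. \<exists>x y. c = {x, y} \<and> mutual_nearest_neighbors M d f x y"
    using two_cycle_orient[OF assms(3,4)] by blast
  then obtain X Y where ends: "\<And>c. c \<in> ?C \<Longrightarrow> c = {X c, Y c}"
    and mutual: "\<And>c. c \<in> ?C \<Longrightarrow> mutual_nearest_neighbors M d f (X c) (Y c)"
    by metis
  have anti: "antisym r"
    using assms(5) unfolding compatible_order_def linear_order_on_def partial_order_on_def by blast
  have "?C \<subseteq> Pow M"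
    unfolding two_cycles_def nn_edges_def by blast
  then have fin: "finite ?C"
    using assms(4) by (meson finite_Pow_iff finite_subset)
  define I where "I = (\<lambda>c. mutual_nearest_neighbors.support M d f (X c) (Y c))"
  define a :: "'m set \<Rightarrow> real \<times> real \<Rightarrow> 'k \<Rightarrow> 'm set \<Rightarrow> 'k" where
    "a = (\<lambda>c. mutual_nearest_neighbors.difference_class M d f (X c) (Y c))"
  define b :: "'m set \<Rightarrow> real \<times> real \<Rightarrow> ('m set \<Rightarrow> 'k) \<Rightarrow> 'k" where
    "b = (\<lambda>c. mutual_nearest_neighbors.coefficient M d f (X c) (Y c))"
  show "card ?C \<le> length (filter (is_interval_module s P) Fs)"
  proof (rule card_le_interval_summands[OF LS Fs fin])
    fix c assume c: "c \<in> ?C"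
    interpret mutual_nearest_neighbors M d f "X c" "Y c" by (rule mutual[OF c])
    show "poset_interval P (I c)"
      unfolding P_def I_def by (rule poset_interval_support)
    show "pm_hom (*) (fun_scale (*)) P (interval_module (I c)) LS (a c)"
      unfolding P_def I_def LS_def a_def by (rule pm_hom_difference_class)
    show "pm_hom (fun_scale (*)) (*) P LS (interval_module (I c)) (b c)"
      unfolding P_def I_def LS_def b_def by (rule pm_hom_coefficient)
  next
    fix c c' p assume c: "c \<in> ?C" "c' \<in> ?C" and I: "I c = I c'" "p \<in> I c"
    have "b c' p (a c p 1) = (if Y c' = Y c then 1 else 0) - (if Y c' = X c then 1 else 0)"
      unfolding a_def b_def
      using I by (intro mutual_nearest_neighbors.coefficient_difference_class mutual c) (simp_all add: I_def)
    also have "\<dots> = (if c' = c then 1 else 0)"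
    proof (cases "c' = c")
      case True
      then show ?thesis
        using mutual_nearest_neighbors.neq[OF mutual[OF c(1)]] by auto
    next
      case False
      then have "Y c' \<notin> c"
        using two_cycles_disjoint[OF anti c] ends[OF c(2)] by blast
      then show ?thesis
        using False ends[OF c(1)] by auto
    qed
    finally show "b c' p (a c p 1) = (if c' = c then 1 else 0)" .
  qed
qed

end
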